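(* Let $\Delta$ be a shellable simplicial complex on the vertex set $[n]=\{1,\dots,n\}$ with $\dim\Delta\le n-3$. Then the intersection lattice $L_\Delta$ of the diagonal arrangement $\mathcal{A}_\Delta$ is homotopy equivalent to a wedge of spheres (i.e. the order complex of $L_\Delta-\{\hat 0,\hat 1\}$ has the homotopy type of a wedge of spheres, not necessarily all of the same dimension).
   Context: For $S\subseteq[n]$, $U_S\subseteq\mathbb{R}^n$ denotes the diagonal subspace $\{u: u_i=u_j \text{ for all } i,j\in S\}$. For a simplicial complex $\Delta$ on $[n]$ with $\dim\Delta\le n-3$, $\mathcal{A}_\Delta=\{U_{[n]-F}: F \text{ a facet of }\Delta\}$. The intersection lattice $L_\Delta$ is the set of all intersections of subspaces of $\mathcal{A}_\Delta$ (including the empty intersection $\mathbb{R}^n$, the bottom element $\hat 0$), ordered by reverse inclusion; its top element $\hat 1$ is the intersection of all subspaces. Topological statements about a lattice refer to the order complex (simplicial complex of chains) of its proper part $L-\{\hat0,\hat1\}$. A simplicial complex is shellable if its facets can be ordered $F_1,\dots,F_q$ so that for each $k\ge2$, $(\bigcup_{i<k}2^{F_i})\cap 2^{F_k}$ is pure of dimension $\dim F_k-1$ (facets may have different dimensions). *)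

theory Defs
  imports "HOL-Analysis.Analysis"
begin

definition simplicial_complex_on :: "nat \<Rightarrow> nat set set \<Rightarrow> bool" where
  "simplicial_complex_on n \<Delta> \<longleftrightarrow> \<Delta> \<noteq> {} \<and> (\<forall>F\<in>\<Delta>. F \<subseteq> {1..n})
     \<and> (\<forall>F\<in>\<Delta>. \<forall>G. G \<subseteq> F \<longrightarrow> G \<in> \<Delta>)"

definition facets :: "'a set set \<Rightarrow> 'a set set" where
  "facets K = {F\<in>K. \<forall>G\<in>K. F \<subseteq> G \<longrightarrow> G = F}"

definition cx_dim_le :: "'a set set \<Rightarrow> int \<Rightarrow> bool" where
  "cx_dim_le K d \<longleftrightarrow> (\<forall>F\<in>K. int (card F) - 1 \<le> d)"

definition pure_of_dim :: "'a set set \<Rightarrow> int \<Rightarrow> bool" where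
  "pure_of_dim K d \<longleftrightarrow> (\<forall>F\<in>facets K. int (card F) - 1 = d)"

text \<open>Shellability (facets possibly of different dimensions). List index k >= 1
  corresponds to the paper's k >= 2.\<close>
definition shellable :: "'a set set \<Rightarrow> bool" where
  "shellable K \<longleftrightarrow> (\<exists>fs. distinct fs \<and> set fs = facets K \<and>
     (\<forall>k. 1 \<le> k \<and> k < length fs \<longrightarrow>
        pure_of_dim ((\<Union>i<k. Pow (fs ! i)) \<inter> Pow (fs ! k))
                    (int (card (fs ! k)) - 1 - 1)))"

definition Rn :: "nat \<Rightarrow> (nat \<Rightarrow> real) set" where
  "Rn n = {u. \<forall>i. i \<notin> {1..n} \<longrightarrow> u i = 0}"

definition diag_subspace :: "nat \<Rightarrow> nat set \<Rightarrow> (nat \<Rightarrow> real) set" where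
  "diag_subspace n S = {u \<in> Rn n. \<forall>i\<in>S. \<forall>j\<in>S. u i = u j}"

definition diag_arrangement :: "nat \<Rightarrow> nat set set \<Rightarrow> (nat \<Rightarrow> real) set set" where
  "diag_arrangement n \<Delta> = (\<lambda>F. diag_subspace n ({1..n} - F)) ` facets \<Delta>"

text \<open>All intersections of subfamilies (empty intersection = R^n).\<close>
definition intersection_lattice :: "nat \<Rightarrow> nat set set \<Rightarrow> (nat \<Rightarrow> real) set set" where
  "intersection_lattice n \<Delta> = {Rn n \<inter> \<Inter> B | B. B \<subseteq> diag_arrangement n \<Delta>}"

definition lattice_bot :: "nat \<Rightarrow> (nat \<Rightarrow> real) set" where
  "lattice_bot n = Rn n"

definition lattice_top :: "nat \<Rightarrow> nat set set \<Rightarrow> (nat \<Rightarrow> real) set" where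
  "lattice_top n \<Delta> = Rn n \<inter> \<Inter> (diag_arrangement n \<Delta>)"

definition proper_part :: "nat \<Rightarrow> nat set set \<Rightarrow> (nat \<Rightarrow> real) set set" where
  "proper_part n \<Delta> = intersection_lattice n \<Delta> - {lattice_bot n, lattice_top n \<Delta>}"

definition order_complex :: "'a set \<Rightarrow> ('a \<Rightarrow> 'a \<Rightarrow> bool) \<Rightarrow> 'a set set" where
  "order_complex P le = {C. C \<subseteq> P \<and> finite C \<and> (\<forall>x\<in>C. \<forall>y\<in>C. le x y \<or> le y x)}"

text \<open>Geometric realization of a finite simplicial complex K with vertex set V,
  as barycentric-coordinate functions (product topology on 'a => real).\<close>
definition geom_realization :: "'a set \<Rightarrow> 'a set set \<Rightarrow> ('a \<Rightarrow> real) set" where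
  "geom_realization V K = {x. (\<forall>v. 0 \<le> x v) \<and> (\<forall>v. v \<notin> V \<longrightarrow> x v = 0)
       \<and> sum x V = 1 \<and> {v. x v \<noteq> 0} \<in> K}"

text \<open>The j-th sphere of dimension d: unit sphere in the coordinates (j,0..d)
  centred at e_(j,0), so it passes through the origin; distinct blocks meet only at 0.\<close>
definition block_sphere :: "nat \<Rightarrow> nat \<Rightarrow> (nat \<times> nat \<Rightarrow> real) set" where
  "block_sphere j d = {x. (\<Sum>i\<le>d. (x (j,i) - (if i = 0 then 1 else 0))^2) = 1
       \<and> (\<forall>a b. (a \<noteq> j \<or> b > d) \<longrightarrow> x (a,b) = 0)}"

text \<open>Wedge of spheres of dimensions ds (a point if ds = []).\<close>
definition wedge_spheres :: "nat list \<Rightarrow> (nat \<times> nat \<Rightarrow> real) topology" where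
  "wedge_spheres ds = top_of_set (insert (\<lambda>_. 0) (\<Union>j<length ds. block_sphere j (ds ! j)))"

text \<open>Homotopy equivalent to a wedge of spheres; the empty space counts as the (-1)-sphere.\<close>
definition htype_wedge_of_spheres :: "'a topology \<Rightarrow> bool" where
  "htype_wedge_of_spheres X \<longleftrightarrow> topspace X = {} \<or>
     (\<exists>ds. X homotopy_equivalent_space wedge_spheres ds)"

end

theory Submission
  imports Defs
begin

text \<open>
  Order the facets by a shelling and add the atoms \<open>U\<^bsub>[n]-F\<^esub>\<close> of the lattice one at a time.
  By induction one finds a set of maximal chains whose removal makes the order complex of the
  proper part nonevasive, hence contractible; as the removed simplices are facets, the
  order complex is then homotopy equivalent to a wedge of their boundary-collapsed copies, which are
  spheres.

  For the induction step let \<open>a\<close> be the last atom.  Deleting \<open>a\<close> leaves a poset that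
  retracts to the lattice of the smaller complex, and the link of \<open>a\<close> retracts to the lattice of
  a complex obtained by contracting \<open>[n] - F\<close> to a point; shellability of \<open>\<Delta>\<close> makes the latter
  shellable again.  The two sets of removed chains fit together because each chain is
  maximal in the whole lattice, so that no chain removed earlier lies in the link of \<open>a\<close>.
  Lattices of subspaces are treated in the inclusion order, i.e. upside down: joins of the
  intersection lattice are meets here, and its atoms lie directly below the bottom \<open>\<real>\<^sup>n\<close>.
\<close>

section \<open>Nonevasive order complexes\<close>

text \<open>Homotopy types alone cannot carry the induction: a cone glued to a wedge of spheres
  along another wedge of spheres need not give a wedge of spheres, as the Hopf map from the
  three-sphere to the two-sphere shows. The induction therefore remembers which simplices have to be
  removed and uses a combinatorial form of contractibility. A nonevasive complex grows from a point
  by adding vertices \<open>x\<close> with nonevasive link \<open>J\<close>, and the deletion and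
  the link of an atom supply just these data; topology enters only after the induction. Neither the
  void complex nor \<open>{{}}\<close> is nonevasive. Hence a lattice with empty proper part is an
  exception, where the empty chain itself is removed, as a sphere of dimension -1; if this happens
  in a link, the atom is isolated and its one-point chain is removed. Contracting
  \<open>[n] - F\<close> changes the complex but not the ambient space: all links are lattices of
  subspaces of the same \<open>\<real>\<^sup>n\<close> inside one fixed lattice, so that maximality
  of chains always refers to intervals of one poset.\<close>

inductive nonevasive :: "'a set set \<Rightarrow> bool" where
  point: "nonevasive {{}, {x}}"
| attach: "nonevasive K \<Longrightarrow> nonevasive J \<Longrightarrow> J \<subseteq> K \<Longrightarrow> x \<notin> \<Union>K \<Longrightarrow> nonevasive (K \<union> insert x ` J)"

text \<open>Comparability is symmetric, so the reversed relation changes nothing; it makes the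
  complexes agree syntactically with the one in the final theorem.\<close>

abbreviation (input) order_chains :: "'a::order set \<Rightarrow> 'a set set" where
  "order_chains P \<equiv> order_complex P (\<lambda>x y. y \<le> x)"

definition comparable_in :: "'a::order set \<Rightarrow> 'a \<Rightarrow> 'a set" where
  "comparable_in P x = {y\<in>P. y \<le> x \<or> x \<le> y}"

text \<open>\<open>C\<close> need not lie in \<open>Q\<close>. For chains in \<open>Q\<close> this
  is ordinary maximality, and it passes to every smaller \<open>Q\<close> without further
  conditions.\<close>

definition maximal_in :: "'a::order set \<Rightarrow> 'a set \<Rightarrow> bool" where
  "maximal_in Q C \<longleftrightarrow> (\<forall>z\<in>Q. C \<subseteq> comparable_in UNIV z \<longrightarrow> z \<in> C)"

lemma maximal_in_mono: "maximal_in Q C \<Longrightarrow> P \<subseteq> Q \<Longrightarrow> maximal_in P C"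
  by (auto simp: maximal_in_def)

lemma order_chains_mono: "P \<subseteq> Q \<Longrightarrow> order_chains P \<subseteq> order_chains Q"
  by (auto simp: order_complex_def)

lemma order_chains_insert:
  assumes "x \<notin> P"
  shows "order_chains (insert x P) = order_chains P \<union> insert x ` order_chains (comparable_in P x)"
proof
  show "order_chains (insert x P) \<subseteq> order_chains P \<union> insert x ` order_chains (comparable_in P x)"
  proof
    fix C assume C: "C \<in> order_chains (insert x P)"
    show "C \<in> order_chains P \<union> insert x ` order_chains (comparable_in P x)"
    proof (cases "x \<in> C")
      case True
      then have "C = insert x (C - {x})" by auto
      moreover have "C - {x} \<in> order_chains (comparable_in P x)"
        using C True by (auto simp: order_complex_def comparable_in_def)
      ultimately show ?thesis by blast
    next
      case False
      then show ?thesis using C by (auto simp: order_complex_def)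
    qed
  qed
  show "order_chains P \<union> insert x ` order_chains (comparable_in P x) \<subseteq> order_chains (insert x P)"
    by (auto simp: order_complex_def comparable_in_def)
qed

text \<open>If a point other than the apex \<open>p\<close> is removed, \<open>p\<close> remains in
  the rest and in the link of that point, so both are smaller cones.\<close>

lemma nonevasive_chains_cone:
  assumes "finite P" "p \<in> P" "P \<subseteq> comparable_in UNIV p"
  shows "nonevasive (order_chains P)"
  using assms
proof (induction "card P" arbitrary: P rule: less_induct)
  case less
  show ?case
  proof (cases "P = {p}")
    case True
    then have "order_chains P = {{}, {p}}" by (auto simp: order_complex_def subset_singleton_iff)
    then show ?thesis by (simp add: nonevasive.point)
  next
    case False
    then obtain x where x: "x \<in> P" "x \<noteq> p" using less.prems by blast
    define R where "R = P - {x}"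
    have R: "x \<notin> R" "insert x R = P" "p \<in> R" "finite R" "R \<subseteq> comparable_in UNIV p"
      using x less.prems by (auto simp: R_def)
    have c: "card R < card P"
      using less.prems(1) x by (metis R_def card_Diff1_less)
    have cc: "card (comparable_in R x) \<le> card R"
      using R by (intro card_mono) (auto simp: comparable_in_def)
    have 1: "nonevasive (order_chains R)" using less.hyps[OF c] R by blast
    have 2: "nonevasive (order_chains (comparable_in R x))"
      using less.hyps[of "comparable_in R x"] c cc R x less.prems
      by (force simp: comparable_in_def)
    have 3: "order_chains (comparable_in R x) \<subseteq> order_chains R"
      by (intro order_chains_mono) (auto simp: comparable_in_def)
    have 4: "x \<notin> \<Union>(order_chains R)" using R by (auto simp: order_complex_def)
    show ?thesis
      using nonevasive.attach[OF 1 2 3 4] order_chains_insert[OF R(1)] R(2) by simp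
  qed
qed

text \<open>The points of \<open>Q - P\<close> are added to \<open>P\<close> one by one, a maximal
  one last. The link of such an \<open>x\<close> is a cone with apex \<open>f x\<close>: what lies
  below \<open>x\<close> is below \<open>f x\<close>, and what lies above \<open>x\<close> is in
  \<open>P\<close>, hence fixed by the monotone \<open>f\<close> and above
  \<open>f x\<close>.\<close>

lemma nonevasive_chains_closure:
  assumes "finite Q" "P \<subseteq> Q"
    and f: "f ` Q \<subseteq> P" "\<And>x. x \<in> Q \<Longrightarrow> x \<le> f x" "\<And>x. x \<in> P \<Longrightarrow> f x = x"
      "\<And>x y. x \<in> Q \<Longrightarrow> y \<in> Q \<Longrightarrow> x \<le> y \<Longrightarrow> f x \<le> f y"
    and C: "\<C> \<subseteq> order_chains P" "\<And>C. C \<in> \<C> \<Longrightarrow> maximal_in Q C"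
    and ne: "nonevasive (order_chains P - \<C>)"
  shows "nonevasive (order_chains Q - \<C>)"
  using assms(1,2) f C(2)
proof (induction "card Q" arbitrary: Q rule: less_induct)
  case less
  show ?case
  proof (cases "Q = P")
    case True
    then show ?thesis using ne by simp
  next
    case False
    then have "finite (Q - P)" "Q - P \<noteq> {}" using less.prems by auto
    then obtain x where x: "x \<in> Q - P" and xmax: "\<And>y. y \<in> Q - P \<Longrightarrow> x \<le> y \<Longrightarrow> x = y"
      by (metis finite_has_maximal)
    define R where "R = Q - {x}"
    have R: "x \<notin> R" "insert x R = Q" "P \<subseteq> R" "finite R" "R \<subseteq> Q"
      using x less.prems by (auto simp: R_def)
    have c: "card R < card Q"
      using less.prems(1) x by (metis DiffD1 R_def card_Diff1_less)
    have 1: "nonevasive (order_chains R - \<C>)"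
    proof (rule less.hyps[OF c])
      show "finite R" "P \<subseteq> R" by (fact R)+
      show "f ` R \<subseteq> P" using less.prems(3) R by blast
      show "x \<le> f x" if "x \<in> R" for x using that less.prems(4) R by blast
      show "f x = x" if "x \<in> P" for x using that less.prems(5) by blast
      show "f x \<le> f y" if "x \<in> R" "y \<in> R" "x \<le> y" for x y
        using that less.prems(6) R by blast
      show "maximal_in R C" if "C \<in> \<C>" for C
        using that less.prems(7) R maximal_in_mono by blast
    qed
    have fx: "f x \<in> P" "f x \<noteq> x" "x \<le> f x" using x less.prems(3,4) by (auto simp: image_subset_iff)
    have 2: "nonevasive (order_chains (comparable_in R x))"
    proof (rule nonevasive_chains_cone)
      show "finite (comparable_in R x)" using R by (auto simp: comparable_in_def)
      show "f x \<in> comparable_in R x" using fx R by (auto simp: comparable_in_def)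
      show "comparable_in R x \<subseteq> comparable_in UNIV (f x)"
      proof
        fix y assume y: "y \<in> comparable_in R x"
        then have yQ: "y \<in> R" "y \<in> Q" using R by (auto simp: comparable_in_def)
        show "y \<in> comparable_in UNIV (f x)"
        proof (cases "y \<le> x")
          case True
          then show ?thesis using fx by (auto simp: comparable_in_def)
        next
          case False
          then have le: "x \<le> y" using y by (auto simp: comparable_in_def)
          then have "y \<in> P" using xmax yQ R by blast
          then have "f y = y" using less.prems(5) by blast
          then have "f x \<le> y" using less.prems(6)[of x y] le x yQ by simp
          then show ?thesis by (auto simp: comparable_in_def)
        qed
      qed
    qed
    \<comment> \<open>A chain in the link of \<open>x\<close> can be extended by \<open>x\<close>,
      so it is not maximal in \<open>Q\<close> and has not been removed.\<close>
    have sub: "order_chains (comparable_in R x) \<subseteq> order_chains R - \<C>"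
    proof
      fix D assume D: "D \<in> order_chains (comparable_in R x)"
      have "D \<notin> \<C>"
      proof
        assume "D \<in> \<C>"
        then have "maximal_in Q D" using less.prems(7) by blast
        moreover have "D \<subseteq> comparable_in UNIV x" 
          using D by (auto simp: order_complex_def comparable_in_def)
        ultimately have "x \<in> D" using x by (auto simp: maximal_in_def)
        then show False using D R by (auto simp: order_complex_def comparable_in_def)
      qed
      then show "D \<in> order_chains R - \<C>"
        using D order_chains_mono[of "comparable_in R x" R] by (auto simp: comparable_in_def)
    qed
    have 4: "x \<notin> \<Union>(order_chains R - \<C>)" using R by (auto simp: order_complex_def)
    have "insert x ` order_chains (comparable_in R x) \<inter> \<C> = {}"
      using C(1) x by (auto simp: order_complex_def)
    then have "order_chains Q - \<C> = (order_chains R - \<C>) \<union> insert x ` order_chains (comparable_in R x)"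
      using order_chains_insert[OF R(1)] R(2) by auto
    then show ?thesis using nonevasive.attach[OF 1 2 sub 4] by simp
  qed
qed

section \<open>Lattices generated by meets, with their closure operators\<close>

definition meets :: "'a::complete_lattice \<Rightarrow> 'a set \<Rightarrow> 'a set" where
  "meets b A = {inf b (Inf B) | B. B \<subseteq> A}"

definition inner_meets :: "'a::complete_lattice \<Rightarrow> 'a set \<Rightarrow> 'a set" where
  "inner_meets b A = meets b A - {b, inf b (Inf A)}"

text \<open>For \<open>x \<le> b\<close> this is the least element of \<open>meets b A\<close> above
  \<open>x\<close>, so it gives the closure operators that \<open>nonevasive_chains_closure\<close>
  asks for.\<close>

definition meet_above :: "'a::complete_lattice \<Rightarrow> 'a set \<Rightarrow> 'a \<Rightarrow> 'a" where
  "meet_above b A x = inf b (Inf {a\<in>A. x \<le> a})"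

lemma meets_le: "x \<in> meets b A \<Longrightarrow> x \<le> b"
  by (auto simp: meets_def)

lemma meets_ge: "x \<in> meets b A \<Longrightarrow> inf b (Inf A) \<le> x"
  unfolding meets_def by (auto intro!: le_infI2[OF Inf_superset_mono])

lemma base_in_meets: "b \<in> meets b A"
  unfolding meets_def by (rule CollectI, rule exI[of _ "{}"]) auto

lemma bottom_in_meets: "inf b (Inf A) \<in> meets b A"
  unfolding meets_def by blast

lemma gen_in_meets: "a \<in> A \<Longrightarrow> a \<le> b \<Longrightarrow> a \<in> meets b A"
  unfolding meets_def by (rule CollectI, rule exI[of _ "{a}"]) (auto simp: inf.absorb2)

lemma meets_mono: "A \<subseteq> A' \<Longrightarrow> meets b A \<subseteq> meets b A'"
  unfolding meets_def by blast

text \<open>Meets of meets are meets, over the union of the index sets. This places the lattice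
  below an atom inside the whole lattice.\<close>

lemma meets_subset_meets:
  assumes "c \<in> meets b A" "B \<subseteq> meets b A"
  shows "meets c B \<subseteq> meets b A"
proof
  fix x assume "x \<in> meets c B"
  then obtain D where D: "D \<subseteq> B" "x = inf c (Inf D)" by (auto simp: meets_def)
  obtain S where S: "S \<subseteq> A" "c = inf b (Inf S)" using assms by (auto simp: meets_def)
  have "\<forall>d\<in>D. \<exists>S. S \<subseteq> A \<and> d = inf b (Inf S)" using D assms by (auto simp: meets_def)
  then obtain s where s: "\<And>d. d \<in> D \<Longrightarrow> s d \<subseteq> A \<and> d = inf b (Inf (s d))" by metis
  have "x = inf b (Inf (S \<union> \<Union>(s ` D)))"
  proof (rule antisym)
    have "x \<le> b" "x \<le> Inf S" using D S by (auto intro: le_infI1)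
    moreover have "x \<le> Inf (s d)" if "d \<in> D" for d
    proof -
      have "x \<le> d" using D that by (auto intro: le_infI2 Inf_lower)
      then show ?thesis using s[OF that] by (metis le_inf_iff)
    qed
    ultimately show "x \<le> inf b (Inf (S \<union> \<Union>(s ` D)))"
      by (auto simp: le_Inf_iff)
  next
    have "inf b (Inf (S \<union> \<Union>(s ` D))) \<le> c"
      unfolding S(2) by (auto intro: le_infI2 Inf_superset_mono)
    moreover have "inf b (Inf (S \<union> \<Union>(s ` D))) \<le> d" if "d \<in> D" for d
    proof -
      have "inf b (Inf (S \<union> \<Union>(s ` D))) \<le> inf b (Inf (s d))"
        using that by (intro inf_mono Inf_superset_mono) auto
      then show ?thesis using s[OF that] by simp
    qed
    ultimately show "inf b (Inf (S \<union> \<Union>(s ` D))) \<le> x"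
      unfolding D(2) by (simp add: le_Inf_iff)
  qed
  moreover have "S \<union> \<Union>(s ` D) \<subseteq> A" using S s by blast
  ultimately show "x \<in> meets b A" unfolding meets_def by blast
qed

lemma meets_obtain_gen:
  assumes "x \<in> meets b A" "x \<noteq> b"
  obtains a where "a \<in> A" "x \<le> a"
proof -
  obtain B where B: "B \<subseteq> A" "x = inf b (Inf B)" using assms by (auto simp: meets_def)
  then have "B \<noteq> {}" using assms by auto
  then obtain a where "a \<in> B" by auto
  then show ?thesis using that[of a] B by (auto intro: le_infI2 Inf_lower)
qed

lemma meet_above_in: "meet_above b A x \<in> meets b A"
  unfolding meet_above_def meets_def by blast

lemma meet_above_ge: "x \<le> b \<Longrightarrow> x \<le> meet_above b A x"
  by (auto simp: meet_above_def le_Inf_iff)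

lemma meet_above_mono: "x \<le> y \<Longrightarrow> meet_above b A x \<le> meet_above b A y"
  unfolding meet_above_def by (intro inf_mono Inf_superset_mono) auto

lemma meet_above_id:
  assumes "x \<in> meets b A"
  shows "meet_above b A x = x"
proof (rule antisym)
  obtain B where B: "B \<subseteq> A" "x = inf b (Inf B)" using assms by (auto simp: meets_def)
  have "B \<subseteq> {a\<in>A. x \<le> a}" using B by (auto intro: le_infI2 Inf_lower)
  then show "meet_above b A x \<le> x"
    unfolding meet_above_def using B(2) by (metis Inf_superset_mono inf_mono order_refl)
  show "x \<le> meet_above b A x" using meet_above_ge meets_le assms by blast
qed

lemma meet_above_less:
  assumes "a \<in> A" "x \<le> a" "a < b"
  shows "meet_above b A x < b"
proof -
  have "meet_above b A x \<le> a" using assms by (auto simp: meet_above_def intro: le_infI2 Inf_lower)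
  then show ?thesis using assms by order
qed

section \<open>Shelled families of lattice elements and the chains to be removed\<close>

locale finite_meet_semilattice =
  fixes \<L> :: "'a::complete_lattice set"
  assumes finite_lattice: "finite \<L>"
    and inf_closed: "x \<in> \<L> \<Longrightarrow> y \<in> \<L> \<Longrightarrow> inf x y \<in> \<L>"
begin

definition covers :: "'a \<Rightarrow> 'a \<Rightarrow> bool" where
  "covers b a \<longleftrightarrow> a \<in> \<L> \<and> b \<in> \<L> \<and> a < b \<and> (\<forall>z\<in>\<L>. a \<le> z \<longrightarrow> z \<le> b \<longrightarrow> z = a \<or> z = b)"

text \<open>A relative of recursive atom orderings, in the inclusion order. The elements of
  \<open>B\<close> are covered by \<open>a\<close>, and every common lower bound of \<open>a\<close>
  and an earlier \<open>a'\<close> lies below one of them, so \<open>B\<close> controls the link of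
  \<open>a\<close>. Covering is meant in the ambient lattice, not just in \<open>meets b A\<close>;
  the maximality of the removed chains depends on this.\<close>

inductive shelled :: "'a \<Rightarrow> 'a set \<Rightarrow> bool" where
  single: "covers b a \<Longrightarrow> shelled b {a}"
| insert: "shelled b A \<Longrightarrow> covers b a \<Longrightarrow> a \<notin> A \<Longrightarrow> shelled a B \<Longrightarrow> B \<subseteq> meets b (insert a A) \<Longrightarrow>
    (\<And>a'. a' \<in> A \<Longrightarrow> \<exists>c\<in>B. inf a a' \<le> c) \<Longrightarrow> shelled b (insert a A)"

lemma shelled_covers: "shelled b A \<Longrightarrow> a \<in> A \<Longrightarrow> covers b a"
  by (induction rule: shelled.induct) auto

lemma shelled_nonempty: "shelled b A \<Longrightarrow> A \<noteq> {}"
  by (induction rule: shelled.induct) auto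

lemma meets_in_lattice:
  assumes "b \<in> \<L>" "A \<subseteq> \<L>"
  shows "meets b A \<subseteq> \<L>"
proof
  fix x assume "x \<in> meets b A"
  then obtain B where B: "B \<subseteq> A" "x = inf b (Inf B)" by (auto simp: meets_def)
  have "finite B" using B assms finite_lattice by (meson finite_subset)
  moreover have "B \<subseteq> \<L>" using B assms by auto
  ultimately have "inf b (Inf B) \<in> \<L>"
  proof (induction B)
    case empty
    then show ?case using assms by simp
  next
    case (insert y F)
    then show ?case using inf_closed[of y "inf b (Inf F)"] by (simp add: inf_left_commute)
  qed
  then show "x \<in> \<L>" using B by simp
qed

lemma covers_antichain: "covers b a \<Longrightarrow> covers b a' \<Longrightarrow> a \<le> a' \<Longrightarrow> a = a'"
  unfolding covers_def by (metis order.strict_implies_order order_less_irrefl)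

text \<open>In the reversed order, the lattice \<open>meets b A\<close> has bottom \<open>b\<close>, atoms \<open>A\<close> and
  top \<open>m\<close>.  The order_chains removed from the order complex are maximal in the interval
  between \<open>b\<close> and \<open>m\<close> of the ambient lattice, not only in \<open>meets b A\<close>; hence they stay
  maximal when further atoms are added.\<close>
theorem shelled_almost_nonevasive:
  assumes "shelled b A"
  shows "\<exists>\<C> \<subseteq> order_chains (inner_meets b A). (\<forall>C\<in>\<C>. maximal_in {z\<in>\<L>. inf b (Inf A) < z \<and> z < b} C) \<and>
    (nonevasive (order_chains (inner_meets b A) - \<C>) \<or> inner_meets b A = {} \<and> \<C> = {{}})"
  using assms
proof (induction rule: shelled.induct)
  case (single b a)
  then have lt: "a < b" by (simp add: covers_def)
  have "inner_meets b {a} = {}"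
    using lt by (auto simp: inner_meets_def meets_def subset_singleton_iff)
  \<comment> \<open>The empty chain is maximal exactly when the open interval is empty, which is
    what covering says.\<close>
  moreover have "maximal_in {z\<in>\<L>. inf b (Inf {a}) < z \<and> z < b} {}"
    using single lt by (auto simp: covers_def maximal_in_def inf.absorb2 order.strict_iff_order)
  moreover have "{} \<in> order_chains (inner_meets b {a})" by (auto simp: order_complex_def)
  ultimately show ?case by (intro exI[of _ "{{}}"]) auto
next
  case (insert b A a B)
  define m where "m = inf b (Inf (insert a A))"
  have bL: "b \<in> \<L>" and aL: "a \<in> \<L>" and ab: "a < b" using insert.hyps(2) by (auto simp: covers_def)
  have AL: "insert a A \<subseteq> \<L>"
    using shelled_covers[OF insert.hyps(1)] aL by (auto simp: covers_def)
  have Alt: "a' < b" if "a' \<in> A" for a'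
    using shelled_covers[OF insert.hyps(1)] that by (auto simp: covers_def)
  define L where "L = meets b (insert a A)"
  have LL: "L \<subseteq> \<L>" unfolding L_def by (rule meets_in_lattice[OF bL AL])
  have finL: "finite L" using LL finite_lattice finite_subset by blast
  have mL: "m \<in> L" unfolding L_def m_def by (rule bottom_in_meets)
  have m_le: "m \<le> x" if "x \<in> L" for x using meets_ge that unfolding L_def m_def by blast
  have L_le: "x \<le> b" if "x \<in> L" for x using meets_le that unfolding L_def by blast
  have aL': "a \<in> L" using gen_in_meets[of a "insert a A" b] ab by (auto simp: L_def)
  have incomp: "\<not> a \<le> a'" "\<not> a' \<le> a" if "a' \<in> A" for a'
    using covers_antichain insert.hyps(2,3) shelled_covers[OF insert.hyps(1) that] that by blast+
  obtain a1 where a1: "a1 \<in> A" using shelled_nonempty[OF insert.hyps(1)] by blast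
  have a1L: "a1 \<in> L" using gen_in_meets[of a1 "insert a A" b] a1 Alt[OF a1] by (auto simp: L_def)
  have am: "m < a" using m_le[OF aL'] m_le[OF a1L] incomp[OF a1] by (metis order_le_less)
  have Am: "m < a'" if "a' \<in> A" for a'
  proof -
    have "a' \<in> L" using gen_in_meets[of a' "insert a A" b] that Alt[OF that] by (auto simp: L_def)
    then show ?thesis using m_le am incomp that by (metis order.strict_iff_order)
  qed
  define X where "X = L - {b, m, a}"
  define P where "P = meets b A - {b, m}"
  have PX: "P \<subseteq> X"
  proof
    fix x assume x: "x \<in> P"
    then have "x \<in> L" using meets_mono[of A "insert a A" b] by (auto simp: P_def L_def)
    moreover have "x \<noteq> a" using meets_obtain_gen[of x b A] x incomp by (auto simp: P_def)
    ultimately show "x \<in> X" using x by (auto simp: P_def X_def)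
  qed
  have gen_above: "\<exists>a'\<in>A. x \<le> a'" if "x \<in> L" "x \<noteq> b" "x \<noteq> a" for x
  proof -
    have "x \<in> L" by fact
    then obtain S where S: "S \<subseteq> insert a A" "x = inf b (Inf S)" by (auto simp: L_def meets_def)
    have "S \<noteq> {}" "S \<noteq> {a}" using S that ab by (auto simp: inf.absorb2)
    then obtain s where "s \<in> S" "s \<in> A" using S by blast
    then show ?thesis using S by (auto intro!: bexI[of _ s] le_infI2 Inf_lower)
  qed
  have fX: "meet_above b A ` X \<subseteq> P"
  proof
    fix y assume "y \<in> meet_above b A ` X"
    then obtain x where x: "x \<in> X" "y = meet_above b A x" by blast
    obtain a' where "a' \<in> A" "x \<le> a'" using gen_above x by (auto simp: X_def)
    then have "y < b" using meet_above_less Alt x by blast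
    moreover have "m < x" using x m_le by (auto simp: X_def order.strict_iff_order)
    then have "m < y" using meet_above_ge[of x b A] L_le x by (force simp: X_def)
    ultimately show "y \<in> P" using x meet_above_in by (auto simp: P_def)
  qed
  have AP: "A \<subseteq> P" using gen_in_meets[of _ A b] Alt Am by (fastforce simp: P_def)
  \<comment> \<open>If the bottom of \<open>meets b A\<close> is already \<open>m\<close>, the
    induction hypothesis applies, and its exceptional case is excluded because \<open>A\<close> lies
    in \<open>P\<close>. Otherwise that bottom belongs to \<open>P\<close> and is comparable to
    everything there, so a cone results and no chain has to be removed.\<close>
  have "\<exists>\<C> \<subseteq> order_chains P. (\<forall>C\<in>\<C>. maximal_in {z\<in>\<L>. m < z \<and> z < b} C) \<and> nonevasive (order_chains P - \<C>)"
  proof (cases "inf b (Inf A) = m")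
    case True
    then have "P = inner_meets b A" by (simp add: P_def inner_meets_def)
    then show ?thesis using insert.IH(1) True AP a1 by auto
  next
    case False
    have "inf b (Inf A) < b" using a1 Alt[OF a1] by (metis Inf_lower inf.coboundedI2 order.strict_trans1)
    then have "inf b (Inf A) \<in> P" using False bottom_in_meets by (auto simp: P_def)
    moreover have "P \<subseteq> comparable_in UNIV (inf b (Inf A))"
      using meets_ge by (auto simp: P_def comparable_in_def)
    moreover have "finite P" using PX finL by (auto simp: X_def intro: finite_subset)
    ultimately have "nonevasive (order_chains P)" by (intro nonevasive_chains_cone)
    then show ?thesis by (intro exI[of _ "{}"]) auto
  qed
  then obtain \<C> where C: "\<C> \<subseteq> order_chains P" "\<And>C. C \<in> \<C> \<Longrightarrow> maximal_in {z\<in>\<L>. m < z \<and> z < b} C"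
    "nonevasive (order_chains P - \<C>)" by blast
  have Xint: "X \<subseteq> {z\<in>\<L>. m < z \<and> z < b}"
    using LL L_le m_le by (auto simp: X_def order.strict_iff_order)
  have neX: "nonevasive (order_chains X - \<C>)"
  proof (rule nonevasive_chains_closure[OF _ PX fX _ _ _ C(1) _ C(3)])
    show "finite X" using finL by (auto simp: X_def)
    show "x \<le> meet_above b A x" if "x \<in> X" for x using that L_le meet_above_ge by (auto simp: X_def)
    show "meet_above b A x = x" if "x \<in> P" for x using that meet_above_id by (auto simp: P_def)
    show "maximal_in X D" if "D \<in> \<C>" for D using C(2)[OF that] Xint maximal_in_mono by blast
  qed (rule meet_above_mono)
  \<comment> \<open>The link of \<open>a\<close> in \<open>X\<close>: only elements below
    \<open>a\<close> occur, since nothing lies strictly between \<open>a\<close> and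
    \<open>b\<close>.\<close>
  define Y where "Y = {x\<in>L. x < a \<and> x \<noteq> m}"
  define Q where "Q = meets a B - {a, m}"
  have Blt: "c < a" if "c \<in> B" for c
    using shelled_covers[OF insert.hyps(4)] that by (auto simp: covers_def)
  have BL: "meets a B \<subseteq> L"
    using meets_subset_meets[of a b "insert a A" B] aL' insert.hyps(5) by (auto simp: L_def)
  have QY: "Q \<subseteq> Y" using BL meets_le[of _ a B] by (auto simp: Q_def Y_def order.strict_iff_order)
  have fY: "meet_above a B ` Y \<subseteq> Q"
  proof
    fix y assume "y \<in> meet_above a B ` Y"
    then obtain x where x: "x \<in> Y" "y = meet_above a B x" by blast
    have "x \<in> L" "x < a" using x by (auto simp: Y_def)
    \<comment> \<open>An element strictly below \<open>a\<close> needs a second generator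
      \<open>a'\<close>; it is then below \<open>inf a a'\<close>, hence below some \<open>c\<close>
      in \<open>B\<close>. So its closure stays strictly below \<open>a\<close>.\<close>
    then obtain a' where a': "a' \<in> A" "x \<le> a'" using gen_above[of x] ab by fastforce
    then obtain c where "c \<in> B" "inf a a' \<le> c" using insert.hyps(6) by blast
    then have "c \<in> B" "x \<le> c" using x a' by (auto simp: Y_def intro: order_trans[of x "inf a a'"])
    then have "y < a" using meet_above_less Blt x by blast
    moreover have "m < x" using x m_le by (auto simp: Y_def order.strict_iff_order)
    then have "m < y" using meet_above_ge[of x a B] x by (force simp: Y_def)
    ultimately show "y \<in> Q" using x meet_above_in by (auto simp: Q_def)
  qed
  have Yint: "Y \<subseteq> {z\<in>\<L>. m < z \<and> z < a}"
    using LL m_le by (auto simp: Y_def order.strict_iff_order)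
  obtain c1 where c1: "c1 \<in> B" using shelled_nonempty[OF insert.hyps(4)] by blast
  have "\<exists>\<D> \<subseteq> order_chains Q. (\<forall>C\<in>\<D>. maximal_in {z\<in>\<L>. m < z \<and> z < a} C) \<and>
     (nonevasive (order_chains Q - \<D>) \<or> Q = {} \<and> \<D> = {{}})"
  proof (cases "inf a (Inf B) = m")
    case True
    then have "Q = inner_meets a B" by (simp add: Q_def inner_meets_def)
    then show ?thesis using insert.IH(2) True by auto
  next
    case False
    have "inf a (Inf B) < a" using c1 Blt[OF c1] by (metis Inf_lower inf.coboundedI2 order.strict_trans1)
    then have "inf a (Inf B) \<in> Q" using False bottom_in_meets by (auto simp: Q_def)
    moreover have "Q \<subseteq> comparable_in UNIV (inf a (Inf B))"
      using meets_ge by (auto simp: Q_def comparable_in_def)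
    moreover have "finite Q" using QY finL by (auto simp: Y_def intro: finite_subset)
    ultimately have "nonevasive (order_chains Q)" by (intro nonevasive_chains_cone)
    then show ?thesis by (intro exI[of _ "{}"]) auto
  qed
  then obtain \<D> where D: "\<D> \<subseteq> order_chains Q" "\<And>C. C \<in> \<D> \<Longrightarrow> maximal_in {z\<in>\<L>. m < z \<and> z < a} C"
    "nonevasive (order_chains Q - \<D>) \<or> Q = {} \<and> \<D> = {{}}" by blast
  have neY: "nonevasive (order_chains Y - \<D>) \<or> order_chains Y - \<D> = {}"
    using D(3)
  proof
    assume ne: "nonevasive (order_chains Q - \<D>)"
    have "nonevasive (order_chains Y - \<D>)"
    proof (rule nonevasive_chains_closure[OF _ QY fY _ _ _ D(1) _ ne])
      show "finite Y" using finL by (auto simp: Y_def)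
      show "x \<le> meet_above a B x" if "x \<in> Y" for x using that by (intro meet_above_ge) (auto simp: Y_def)
      show "meet_above a B x = x" if "x \<in> Q" for x using that meet_above_id by (auto simp: Q_def)
      show "maximal_in Y D'" if "D' \<in> \<D>" for D' using D(2)[OF that] Yint maximal_in_mono by blast
    qed (rule meet_above_mono)
    then show ?thesis by blast
  next
    \<comment> \<open>Here the link has no points. Its only chain is the empty one, which is in
      \<open>\<D>\<close>, so \<open>{a}\<close> becomes a removed chain and nothing is
      attached.\<close>
    assume "Q = {} \<and> \<D> = {{}}"
    then show ?thesis using fY by (auto simp: order_complex_def)
  qed
  have inner: "inner_meets b (insert a A) = insert a X"
    using am ab aL' by (auto simp: inner_meets_def X_def L_def m_def)
  have aX: "a \<notin> X" by (simp add: X_def)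
  have no_between: "\<not> (a \<le> z \<and> z \<noteq> a \<and> z < b)" if "z \<in> \<L>" for z
    using insert.hyps(2) that by (auto simp: covers_def)
  have YX: "comparable_in X a = Y"
    using Xint no_between ab aX am by (auto simp: comparable_in_def X_def Y_def)
  have ch: "order_chains (inner_meets b (insert a A)) = order_chains X \<union> insert a ` order_chains Y"
    using order_chains_insert[OF aX] YX inner by simp
  define \<E> where "\<E> = \<C> \<union> insert a ` \<D>"
  have DY: "\<D> \<subseteq> order_chains Y" using D(1) order_chains_mono[OF QY] by blast
  have CX: "\<C> \<subseteq> order_chains X" using C(1) order_chains_mono[OF PX] by blast
  have aY: "a \<notin> Y" by (simp add: Y_def)
  have E1: "\<E> \<subseteq> order_chains (inner_meets b (insert a A))"
    unfolding \<E>_def ch using CX DY by blast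
  have E2: "maximal_in {z\<in>\<L>. m < z \<and> z < b} E" if "E \<in> \<E>" for E
  proof (cases "E \<in> \<C>")
    case True
    then show ?thesis using C(2) by blast
  next
    case False
    then obtain D' where D': "D' \<in> \<D>" "E = insert a D'" using \<open>E \<in> \<E>\<close> by (auto simp: \<E>_def)
    show ?thesis unfolding maximal_in_def
    proof (intro ballI impI)
      fix z assume z: "z \<in> {z\<in>\<L>. m < z \<and> z < b}" and zE: "E \<subseteq> comparable_in UNIV z"
      show "z \<in> E"
      proof (cases "z = a")
        case True
        then show ?thesis using D' by blast
      next
        case False
        \<comment> \<open>Comparability with \<open>a\<close> leaves only \<open>z < a\<close>, as
          \<open>z\<close> cannot lie between \<open>a\<close> and \<open>b\<close>; then the
          maximality of \<open>D'\<close> in the interval below \<open>a\<close> decides.\<close>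
        then have "z < a" using z zE D' no_between[of z] by (auto simp: comparable_in_def)
        then show ?thesis using D(2)[OF D'(1)] z zE D' by (auto simp: maximal_in_def)
      qed
    qed
  qed
  have anX: "a \<notin> \<Union>(order_chains X - \<C>)" using aX by (auto simp: order_complex_def)
  have notDX: "insert a S \<notin> order_chains X" for S using aX by (auto simp: order_complex_def)
  have anY: "S \<in> order_chains Y \<Longrightarrow> a \<notin> S" for S using aY by (auto simp: order_complex_def)
  have inj: "insert a S = insert a S' \<Longrightarrow> S \<in> order_chains Y \<Longrightarrow> S' \<in> order_chains Y \<Longrightarrow> S = S'" for S S'
    using anY by (metis insert_ident)
  have E3: "order_chains (inner_meets b (insert a A)) - \<E> = (order_chains X - \<C>) \<union> insert a ` (order_chains Y - \<D>)"
  proof -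
    have "insert a ` order_chains Y \<inter> \<C> = {}" using notDX CX by blast
    moreover have "order_chains X \<inter> insert a ` \<D> = {}" using notDX by blast
    moreover have "insert a ` order_chains Y - insert a ` \<D> = insert a ` (order_chains Y - \<D>)"
      using inj DY by blast
    moreover have "(U \<union> V) - (S \<union> T) = (U - S) \<union> (V - T)"
      if "V \<inter> S = {}" "U \<inter> T = {}" for U V S T :: "'a set set"
      using that by blast
    ultimately show ?thesis unfolding ch \<E>_def by simp
  qed
  have sub: "order_chains Y - \<D> \<subseteq> order_chains X - \<C>"
  proof
    fix S assume S: "S \<in> order_chains Y - \<D>"
    have "Y \<subseteq> X" using YX by (auto simp: comparable_in_def)
    then have "S \<in> order_chains X" using S order_chains_mono by blast
    moreover have "S \<notin> \<C>"
    proof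
      assume "S \<in> \<C>"
      then have "maximal_in {z\<in>\<L>. m < z \<and> z < b} S" using C(2) by blast
      moreover have "S \<subseteq> comparable_in UNIV a"
        using S by (auto simp: order_complex_def comparable_in_def Y_def)
      ultimately have "a \<in> S" using am ab aL by (auto simp: maximal_in_def)
      then show False using S anY by blast
    qed
    ultimately show "S \<in> order_chains X - \<C>" by blast
  qed
  have "nonevasive (order_chains (inner_meets b (insert a A)) - \<E>)"
    using neY
  proof
    assume "nonevasive (order_chains Y - \<D>)"
    then show ?thesis unfolding E3 using nonevasive.attach[OF neX _ sub anX] by blast
  next
    assume "order_chains Y - \<D> = {}"
    then show ?thesis unfolding E3 using neX by (simp only: image_empty Un_empty_right)
  qed
  then show ?case using E1 E2[unfolded m_def] by (intro exI[of _ \<E>] conjI ballI disjI1)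
qed

end

section \<open>Diagonal arrangements of shellable complexes\<close>

text \<open>The labelling \<open>c\<close> encodes the set partition into its fibres; \<open>S\<close> is a set of labels, whose
  fibres are merged into one block.\<close>
definition glued :: "nat \<Rightarrow> (nat \<Rightarrow> nat) \<Rightarrow> nat set \<Rightarrow> (nat \<Rightarrow> real) set" where
  "glued n c S = {u\<in>Rn n. \<forall>i\<in>{1..n}. \<forall>j\<in>{1..n}. c i = c j \<or> c i \<in> S \<and> c j \<in> S \<longrightarrow> u i = u j}"

text \<open>Test vectors. For a set \<open>S\<close> of at least two occurring labels, they lie in
  \<open>glued n c S\<close> exactly for labels outside \<open>S\<close>, so the subspace determines
  \<open>S\<close>.\<close>

definition fibre_ind :: "nat \<Rightarrow> (nat \<Rightarrow> nat) \<Rightarrow> nat \<Rightarrow> nat \<Rightarrow> real" where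
  "fibre_ind n c p i = (if i \<in> {1..n} \<and> c i = p then 1 else 0)"

lemma fibre_ind_in_glued: "p \<notin> S \<Longrightarrow> fibre_ind n c p \<in> glued n c S"
  by (auto simp: fibre_ind_def glued_def Rn_def)

lemma fibre_ind_notin_glued:
  assumes "p \<in> S" "S \<subseteq> c ` {1..n}" "2 \<le> card S"
  shows "fibre_ind n c p \<notin> glued n c S"
proof
  assume u: "fibre_ind n c p \<in> glued n c S"
  have "S \<noteq> {p}" using assms by auto
  then obtain q where q: "q \<in> S" "q \<noteq> p" using assms by blast
  then obtain i j where "i \<in> {1..n}" "c i = p" "j \<in> {1..n}" "c j = q" using assms by blast
  then have "fibre_ind n c p i = fibre_ind n c p j" using u q assms(1) unfolding glued_def by blast
  then show False using \<open>i \<in> {1..n}\<close> \<open>c i = p\<close> \<open>c j = q\<close> q by (simp add: fibre_ind_def)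
qed

lemma glued_inject:
  assumes "glued n c A = glued n c B" "A \<subseteq> c ` {1..n}" "2 \<le> card A" "B \<subseteq> c ` {1..n}" "2 \<le> card B"
  shows "A = B"
proof (rule subset_antisym)
  show "A \<subseteq> B" using assms fibre_ind_in_glued[of _ B n c] fibre_ind_notin_glued[of _ A c n] by blast
  show "B \<subseteq> A" using assms fibre_ind_in_glued[of _ A n c] fibre_ind_notin_glued[of _ B c n] by blast
qed

lemma glued_antimono: "A \<subseteq> B \<Longrightarrow> glued n c B \<subseteq> glued n c A"
  unfolding glued_def by blast

lemma diag_subspace_eq_glued: "G \<subseteq> {1..n} \<Longrightarrow> diag_subspace n G = glued n id G"
  unfolding diag_subspace_def glued_def by auto

lemma Rn_eq_glued: "Rn n = glued n id {}"
  by (auto simp: glued_def)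

text \<open>Performs a merging on the level of labels: after \<open>c\<close>, the fibres with label
  in \<open>S\<close> form one fibre, named \<open>v\<close>. Taking \<open>v\<close> from
  \<open>S\<close> ensures that no other fibre bears this name.\<close>

definition contract :: "nat set \<Rightarrow> nat \<Rightarrow> nat \<Rightarrow> nat" where
  "contract S v x = (if x \<in> S then v else x)"

text \<open>If \<open>A\<close> meets \<open>S\<close>, the two merged blocks share a fibre and fuse
  into one, and the image of \<open>A\<close> then contains \<open>v\<close>. If not, both blocks
  persist side by side, the one as the fibre of \<open>v\<close> and the other as \<open>A\<close>
  itself.\<close>

lemma glued_contract_Int:
  assumes "v \<in> S" "A \<subseteq> c ` {1..n}"
  shows "glued n (contract S v \<circ> c) (contract S v ` A) = glued n c S \<inter> glued n c A"
proof
  show "glued n (contract S v \<circ> c) (contract S v ` A) \<subseteq> glued n c S \<inter> glued n c A"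
  proof
    fix u assume u: "u \<in> glued n (contract S v \<circ> c) (contract S v ` A)"
    have eq: "u i = u j" if "i \<in> {1..n}" "j \<in> {1..n}"
      "contract S v (c i) = contract S v (c j) \<or>
        contract S v (c i) \<in> contract S v ` A \<and> contract S v (c j) \<in> contract S v ` A" for i j
      using u that unfolding glued_def comp_apply mem_Collect_eq by blast
    show "u \<in> glued n c S \<inter> glued n c A"
      unfolding glued_def
    proof (intro IntI CollectI conjI ballI impI)
      show "u \<in> Rn n" "u \<in> Rn n" using u unfolding glued_def by blast+
      fix i j assume ij: "i \<in> {1..n}" "j \<in> {1..n}"
      show "u i = u j" if "c i = c j \<or> c i \<in> S \<and> c j \<in> S"
        using that by (intro eq ij) (auto simp: contract_def)
      show "u i = u j" if "c i = c j \<or> c i \<in> A \<and> c j \<in> A"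
        using that by (intro eq ij) auto
    qed
  qed
  show "glued n c S \<inter> glued n c A \<subseteq> glued n (contract S v \<circ> c) (contract S v ` A)"
  proof
    fix u assume "u \<in> glued n c S \<inter> glued n c A"
    then have uR: "u \<in> Rn n"
      and uc: "\<And>i j. i \<in> {1..n} \<Longrightarrow> j \<in> {1..n} \<Longrightarrow> c i = c j \<Longrightarrow> u i = u j"
      and uS: "\<And>i j. i \<in> {1..n} \<Longrightarrow> j \<in> {1..n} \<Longrightarrow> c i \<in> S \<Longrightarrow> c j \<in> S \<Longrightarrow> u i = u j"
      and uA: "\<And>i j. i \<in> {1..n} \<Longrightarrow> j \<in> {1..n} \<Longrightarrow> c i \<in> A \<Longrightarrow> c j \<in> A \<Longrightarrow> u i = u j"
      unfolding glued_def by blast+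
    have eq: "u i = u j" if ij: "i \<in> {1..n}" "j \<in> {1..n}"
      and mem: "contract S v (c i) \<in> contract S v ` A" "contract S v (c j) \<in> contract S v ` A" for i j
    proof (cases "A \<inter> S = {}")
      case True
      then have "c l \<in> A" if "contract S v (c l) \<in> contract S v ` A" for l
        using that assms by (auto simp: contract_def split: if_splits)
      then show ?thesis using uA ij mem by blast
    next
      case False
      then obtain k where k: "k \<in> {1..n}" "c k \<in> A" "c k \<in> S" using assms by blast
      have "c l \<in> S \<or> c l \<in> A" if "contract S v (c l) \<in> contract S v ` A" for l
        using that assms by (auto simp: contract_def split: if_splits)
      then have "u l = u k" if "l \<in> {1..n}" "contract S v (c l) \<in> contract S v ` A" for l
        using uS uA k that by blast
      then show ?thesis using ij mem by metis
    qed
    show "u \<in> glued n (contract S v \<circ> c) (contract S v ` A)"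
      unfolding glued_def
    proof (intro CollectI conjI ballI impI)
      fix i j assume ij: "i \<in> {1..n}" "j \<in> {1..n}"
        and d: "(contract S v \<circ> c) i = (contract S v \<circ> c) j \<or>
          (contract S v \<circ> c) i \<in> contract S v ` A \<and> (contract S v \<circ> c) j \<in> contract S v ` A"
      show "u i = u j"
        using d
      proof
        assume "(contract S v \<circ> c) i = (contract S v \<circ> c) j"
        then show ?thesis using uc[OF ij] uS[OF ij] assms(1) by (auto simp: contract_def split: if_splits)
      next
        assume "(contract S v \<circ> c) i \<in> contract S v ` A \<and> (contract S v \<circ> c) j \<in> contract S v ` A"
        then show ?thesis by (intro eq ij) simp_all
      qed
    qed (rule uR)
  qed
qed

lemma glued_contract:
  assumes "v \<in> S"
  shows "glued n (contract S v \<circ> c) {} = glued n c S"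
  using glued_contract_Int[OF assms, of "{}" c n] glued_antimono[of "{}" S n c] by auto

text \<open>The condition on the complements of the facets that expresses shellability; the list is in
  reverse shelling order.\<close>
fun linear_quotients :: "'a set list \<Rightarrow> bool" where
  "linear_quotients [] \<longleftrightarrow> True"
| "linear_quotients (S # As) \<longleftrightarrow> linear_quotients As \<and>
     (\<forall>A\<in>set As. \<exists>B\<in>set As. \<exists>w\<in>A - S. B - S = {w})"

lemma linear_quotients_star:
  assumes "distinct ws" "v \<notin> set ws"
  shows "linear_quotients (map (\<lambda>w. {v, w}) ws)"
  using assms by (induction ws) auto

text \<open>The new list collects the inclusion-minimal sets that remain when \<open>S\<close> is
  contracted to \<open>v\<close>. For disjoint-from-\<open>S\<close> sets \<open>T\<close> and
  \<open>A\<close>, the old witness \<open>B\<close> is contained in \<open>T \<union> {w}\<close>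
  with \<open>w \<in> A\<close>, so it avoids \<open>S\<close> too. Against an edge
  \<open>{v, w}\<close>, the witness is an edge \<open>{v, w'}\<close> with
  \<open>w' \<in> T\<close>, whose only element outside \<open>T\<close> is
  \<open>v\<close>.\<close>

lemma linear_quotients_contract:
  assumes "linear_quotients (S # As)" "v \<in> S" "distinct ws"
    and ws: "set ws = {w. \<exists>A\<in>set As. A - S = {w}}"
  shows "linear_quotients (filter (\<lambda>A. A \<inter> S = {}) As @ map (\<lambda>w. {v, w}) ws)"
proof -
  \<comment> \<open>The condition at the head \<open>S\<close> puts the single excess label of some
    \<open>B\<close> into \<open>T\<close>.\<close>
  have ex: "\<exists>w\<in>set ws. w \<in> T" if T: "T \<in> set As" for T
  proof -
    obtain B w where "B \<in> set As" "w \<in> T - S" "B - S = {w}" using assms(1) T by auto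
    then show ?thesis using ws by auto
  qed
  have "v \<notin> set ws" using ws assms(2) by auto
  then have star: "linear_quotients (map (\<lambda>w. {v, w}) ws)"
    by (rule linear_quotients_star[OF assms(3)])
  have "linear_quotients (filter (\<lambda>A. A \<inter> S = {}) Bs @ map (\<lambda>w. {v, w}) ws)"
    if "linear_quotients Bs" "set Bs \<subseteq> set As" for Bs
    using that
  proof (induction Bs)
    case Nil
    then show ?case using star by simp
  next
    case (Cons T Bs)
    let ?Ds = "filter (\<lambda>A. A \<inter> S = {}) Bs @ map (\<lambda>w. {v, w}) ws"
    have IH: "linear_quotients ?Ds" using Cons by simp
    show ?case
    proof (cases "T \<inter> S = {}")
      case True
      have step: "\<exists>B\<in>set ?Ds. \<exists>w\<in>A - T. B - T = {w}" if A: "A \<in> set ?Ds" for A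
      proof (cases "A \<in> set Bs \<and> A \<inter> S = {}")
        case True
        then obtain B w where B: "B \<in> set Bs" "w \<in> A - T" "B - T = {w}"
          using Cons.prems(1) by auto
        have "x \<notin> S" if "x \<in> B" for x
        proof -
          have "x \<in> T \<or> x = w" using that B(3) by blast
          then show ?thesis using B(2) True \<open>T \<inter> S = {}\<close> by auto
        qed
        then have "B \<inter> S = {}" by auto
        then show ?thesis using B by auto
      next
        case False
        then obtain w where w: "w \<in> set ws" "A = {v, w}" using A by auto
        obtain w' where w': "w' \<in> set ws" "w' \<in> T" using ex Cons.prems(2) by auto
        have "{v, w'} - T = {v}" "v \<in> A - T" using w w' True assms(2) by auto
        moreover have "{v, w'} \<in> set ?Ds" using w'(1) by simp
        ultimately show ?thesis by blast
      qed
      have eq: "filter (\<lambda>A. A \<inter> S = {}) (T # Bs) @ map (\<lambda>w. {v, w}) ws = T # ?Ds"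
        using True by simp
      show ?thesis unfolding eq linear_quotients.simps by (intro conjI ballI IH step)
    next
      case False
      then show ?thesis using IH by simp
    qed
  qed
  then show ?thesis using assms(1) by simp
qed

section \<open>Covering relations and shelled families in the diagonal lattice\<close>

locale diagonal_lattice =
  fixes n :: nat and \<G> :: "nat set set"
  assumes \<G>_subset: "G \<in> \<G> \<Longrightarrow> G \<subseteq> {1..n}"
begin

abbreviation \<L> :: "(nat \<Rightarrow> real) set set" where
  "\<L> \<equiv> meets (Rn n) (diag_subspace n ` \<G>)"

sublocale finite_meet_semilattice \<L>
proof
  have "\<G> \<subseteq> Pow {1..n}" using \<G>_subset by auto
  then have "finite \<G>" by (rule finite_subset) auto
  then have "finite (Pow (diag_subspace n ` \<G>))" by simp
  moreover have "\<L> = (\<lambda>B. inf (Rn n) (Inf B)) ` Pow (diag_subspace n ` \<G>)"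
    by (auto simp: meets_def)
  ultimately show "finite \<L>" by simp
next
  fix x y assume "x \<in> \<L>" "y \<in> \<L>"
  then have "meets x {y} \<subseteq> \<L>" by (intro meets_subset_meets) auto
  moreover have "inf x y \<in> meets x {y}" using bottom_in_meets[of x "{y}"] by simp
  ultimately show "inf x y \<in> \<L>" by blast
qed

text \<open>An element in between is an intersection of subspaces given by sets \<open>G\<close>.
  Each \<open>G\<close> lies in one fibre, and then imposes no condition on
  \<open>glued n c {}\<close>, or has image \<open>A\<close>, and then cuts down to
  \<open>glued n c A\<close>.\<close>

lemma covers_glued:
  assumes "A \<subseteq> c ` {1..n}" "2 \<le> card A" "glued n c A \<in> \<L>" "glued n c {} \<in> \<L>"
    and min: "\<And>G. G \<in> \<G> \<Longrightarrow> c ` G \<subseteq> A \<Longrightarrow> (\<exists>w. c ` G \<subseteq> {w}) \<or> c ` G = A"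
  shows "covers (glued n c {}) (glued n c A)"
  unfolding covers_def
proof (intro conjI ballI impI)
  obtain p where "p \<in> A" using assms(2) by fastforce
  then show "glued n c A < glued n c {}"
    using fibre_ind_notin_glued[of p A c n] fibre_ind_in_glued[of p "{}" n c] assms
      glued_antimono[of "{}" A n c] by auto
  fix z assume "z \<in> \<L>" and z1: "glued n c A \<le> z" and z2: "z \<le> glued n c {}"
  then obtain B where B: "B \<subseteq> \<G>" and z: "z = Rn n \<inter> \<Inter>(diag_subspace n ` B)"
    by (auto simp: meets_def subset_image_iff)
  have G: "(\<exists>w. c ` G \<subseteq> {w}) \<or> c ` G = A" if "G \<in> B" for G
  proof (cases "c ` G \<subseteq> A")
    case True
    then show ?thesis using min that B by blast
  next
    case False
    then obtain i where i: "i \<in> G" "c i \<notin> A" by blast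
    \<comment> \<open>The label \<open>c i\<close> is outside \<open>A\<close>, so its test vector
      survives in \<open>z\<close>. It equals 1 at \<open>i\<close> and must be constant on
      \<open>G\<close>, which forces \<open>G\<close> into the fibre of \<open>c i\<close>.\<close>
    have "fibre_ind n c (c i) \<in> z" using z1 fibre_ind_in_glued[OF i(2)] by blast
    then have u: "fibre_ind n c (c i) \<in> diag_subspace n G" using z that by blast
    have "c j = c i" if "j \<in> G" for j
    proof -
      have "fibre_ind n c (c i) j = fibre_ind n c (c i) i"
        using u that i unfolding diag_subspace_def by blast
      moreover have "i \<in> {1..n}" using \<G>_subset \<open>G \<in> B\<close> B i by blast
      ultimately show ?thesis by (auto simp: fibre_ind_def split: if_splits)
    qed
    then show ?thesis by blast
  qed
  show "z = glued n c A \<or> z = glued n c {}"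
  proof (cases "\<exists>G\<in>B. c ` G = A")
    case True
    then obtain G where GB: "G \<in> B" "c ` G = A" by blast
    have "z \<subseteq> glued n c A"
    proof
      fix u assume u: "u \<in> z"
      then have u1: "u \<in> glued n c {}" and u2: "u \<in> diag_subspace n G" using z2 z GB by auto
      show "u \<in> glued n c A" unfolding glued_def
      proof (intro CollectI conjI ballI impI)
        show "u \<in> Rn n" using u2 by (simp add: diag_subspace_def)
        fix i j assume ij: "i \<in> {1..n}" "j \<in> {1..n}" "c i = c j \<or> c i \<in> A \<and> c j \<in> A"
        show "u i = u j"
        proof (cases "c i = c j")
          case True
          then show ?thesis using u1 ij unfolding glued_def by blast
        next
          case False
          then obtain i' j' where i'j': "i' \<in> G" "j' \<in> G" "c i' = c i" "c j' = c j" using ij GB by (metis imageE)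
          then have "i' \<in> {1..n}" "j' \<in> {1..n}" using \<G>_subset GB B by blast+
          moreover have "u x = u y" if "x \<in> {1..n}" "y \<in> {1..n}" "c x = c y" for x y
            using u1 that unfolding glued_def by blast
          ultimately have "u i = u i'" "u j = u j'" using ij(1,2) i'j'(3,4) by metis+
          moreover have "u i' = u j'" using u2 i'j' unfolding diag_subspace_def by blast
          ultimately show ?thesis by simp
        qed
      qed
    qed
    then show ?thesis using z1 by blast
  next
    case False
    have "glued n c {} \<subseteq> z"
    proof
      fix u assume u: "u \<in> glued n c {}"
      have "u \<in> diag_subspace n G" if GB: "G \<in> B" for G
      proof -
        obtain w where w: "c ` G \<subseteq> {w}" using G False GB by blast
        have "G \<subseteq> {1..n}" using \<G>_subset GB B by blast
        then have "c i = c j" "i \<in> {1..n}" "j \<in> {1..n}" if "i \<in> G" "j \<in> G" for i j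
          using that w by blast+
        then show ?thesis using u unfolding diag_subspace_def glued_def by blast
      qed
      then show "u \<in> z" using u z by (auto simp: glued_def)
    qed
    then show ?thesis using z2 by blast
  qed
qed (use assms in auto)

text \<open>Two nested inductions: on the list for the family without the head, and on the number of
  labels for the interval below the head, where \<open>contract S v \<circ> c\<close> replaces
  \<open>c\<close>. By the last hypothesis no generator has an image with several labels strictly
  inside a set of \<open>As\<close>; this yields covering in the whole lattice and survives
  contraction.\<close>

lemma shelled_glued:
  assumes "linear_quotients As" "As \<noteq> []" "distinct As"
    and "\<And>A. A \<in> set As \<Longrightarrow> A \<subseteq> c ` {1..n} \<and> 2 \<le> card A \<and> glued n c A \<in> \<L>"
    and "glued n c {} \<in> \<L>"
    and "\<And>A G. A \<in> set As \<Longrightarrow> G \<in> \<G> \<Longrightarrow> c ` G \<subseteq> A \<Longrightarrow> (\<exists>w. c ` G \<subseteq> {w}) \<or> c ` G = A"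
  shows "shelled (glued n c {}) (glued n c ` set As)"
  using assms
proof (induction "card (c ` {1..n})" arbitrary: c As rule: less_induct)
  case less
  note outer = less.hyps
  show ?case
    using less.prems
  proof (induction As)
    case Nil
    then show ?case by simp
  next
    case (Cons S As)
    let ?b = "glued n c {}" and ?a = "glued n c S"
    have S: "S \<subseteq> c ` {1..n}" "2 \<le> card S" "?a \<in> \<L>" using Cons.prems(4)[of S] by auto
    have cov: "covers ?b ?a"
      using S Cons.prems(5) Cons.prems(6)[of S] by (intro covers_glued) auto
    show ?case
    proof (cases "As = []")
      case True
      then show ?thesis using shelled.single[OF cov] by simp
    next
      case False
      have sh: "shelled ?b (glued n c ` set As)"
      proof (rule Cons.IH)
        show "linear_quotients As" "As \<noteq> []" "distinct As" using Cons.prems False by auto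
        show "\<And>A. A \<in> set As \<Longrightarrow> A \<subseteq> c ` {1..n} \<and> 2 \<le> card A \<and> glued n c A \<in> \<L>"
          using Cons.prems(4) by auto
        show "?b \<in> \<L>" by fact
        show "\<And>A G. A \<in> set As \<Longrightarrow> G \<in> \<G> \<Longrightarrow> c ` G \<subseteq> A \<Longrightarrow> (\<exists>w. c ` G \<subseteq> {w}) \<or> c ` G = A"
          using Cons.prems(6) by auto
      qed
      have As: "A \<subseteq> c ` {1..n}" "2 \<le> card A" "glued n c A \<in> \<L>" if "A \<in> set As" for A
        using Cons.prems(4)[of A] that by auto
      have fresh: "?a \<notin> glued n c ` set As"
        using glued_inject[of n c S] S As Cons.prems(3) by auto
      obtain v where v: "v \<in> S" using S(2) by fastforce
      \<comment> \<open>Sets with one label \<open>w\<close> outside \<open>S\<close> turn into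
        edges \<open>{v, w}\<close>. A set that meets \<open>S\<close> with a larger excess contains
        such an edge after contraction, so it contributes nothing new.\<close>
      define R where "R = {w. \<exists>A\<in>set As. A - S = {w}}"
      have "R \<subseteq> \<Union>(set As)" by (auto simp: R_def)
      moreover have "\<Union>(set As) \<subseteq> c ` {1..n}" using As(1) by (intro Union_least)
      then have "finite (\<Union>(set As))" by (rule finite_subset) simp
      ultimately have "finite R" by (rule finite_subset)
      then obtain ws where ws: "set ws = R" "distinct ws" using finite_distinct_list by blast
      have vR: "v \<notin> R" "R \<inter> S = {}" using v by (auto simp: R_def)
      let ?Bs = "filter (\<lambda>A. A \<inter> S = {}) As @ map (\<lambda>w. {v, w}) ws"
      let ?k = "contract S v"
      have k_disj: "?k ` A = A" if "A \<inter> S = {}" for A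
        using that by (force simp: contract_def)
      have k_edge: "?k ` A = {v, w}" if "A \<in> set As" "A - S = {w}" for A w
      proof -
        have "A \<noteq> {w}" using As(2)[OF that(1)] by auto
        then have "A \<inter> S \<noteq> {}" using that by blast
        then show ?thesis using that v by (auto simp: contract_def image_def)
      qed
      have Bs: "\<exists>A\<in>set As. B = ?k ` A" if B: "B \<in> set ?Bs" for B
      proof (cases "B \<in> set As \<and> B \<inter> S = {}")
        case True
        then show ?thesis using k_disj by blast
      next
        case False
        then obtain w where "w \<in> R" "B = {v, w}" using B ws by auto
        then show ?thesis using k_edge unfolding R_def by blast
      qed
      have inter: "glued n (?k \<circ> c) (?k ` A) = ?a \<inter> glued n c A" if "A \<in> set As" for A
        using glued_contract_Int v As that by blast
      have ex: "\<exists>B\<in>set ?Bs. B \<subseteq> ?k ` A" if A: "A \<in> set As" for A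
      proof (cases "A \<inter> S = {}")
        case True
        then show ?thesis using A k_disj[OF True] by (intro bexI[of _ A]) auto
      next
        case False
        obtain A' w where w: "A' \<in> set As" "w \<in> A - S" "A' - S = {w}"
          using Cons.prems(1) A by auto
        then have "w \<in> set ws" using ws by (auto simp: R_def)
        then have "{v, w} \<in> set ?Bs" by simp
        moreover have "{v, w} \<subseteq> ?k ` A" using False w by (auto simp: contract_def image_def)
        ultimately show ?thesis by blast
      qed
      have shB: "shelled (glued n (?k \<circ> c) {}) (glued n (?k \<circ> c) ` set ?Bs)"
      proof (rule outer)
        have "?k ` (c ` {1..n}) \<subseteq> insert v (c ` {1..n} - S)" by (auto simp: contract_def)
        then have "card ((?k \<circ> c) ` {1..n}) \<le> card (insert v (c ` {1..n} - S))"
          by (intro card_mono) (auto simp: image_comp)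
        also have "\<dots> \<le> Suc (card (c ` {1..n} - S))" by (simp add: card_insert_if)
        also have "\<dots> = Suc (card (c ` {1..n}) - card S)"
          using S by (simp add: card_Diff_subset finite_subset)
        also have "\<dots> < card (c ` {1..n})"
          using S(2) card_mono[OF _ S(1)] by simp
        finally show "card ((?k \<circ> c) ` {1..n}) < card (c ` {1..n})" .
        show "linear_quotients ?Bs"
          using linear_quotients_contract[OF Cons.prems(1) v ws(2)] ws(1) by (simp add: R_def)
        show "?Bs \<noteq> []"
        proof -
          obtain A where "A \<in> set As" using False by (meson list.set_sel(1))
          then show ?thesis using ex by fastforce
        qed
        show "distinct ?Bs"
        proof -
          have "inj_on (\<lambda>w. {v, w}) (set ws)" using vR ws by (auto simp: inj_on_def doubleton_eq_iff)
          moreover have "distinct As" using Cons.prems(3) by simp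
          ultimately show ?thesis using ws v by (auto simp: distinct_map)
        qed
        show "B \<subseteq> (?k \<circ> c) ` {1..n} \<and> 2 \<le> card B \<and> glued n (?k \<circ> c) B \<in> \<L>" if B: "B \<in> set ?Bs" for B
        proof (intro conjI)
          obtain A where A: "A \<in> set As" "B = ?k ` A" using Bs B by blast
          show "B \<subseteq> (?k \<circ> c) ` {1..n}"
            using As(1)[OF A(1)] A(2) by (metis image_comp image_mono)
          show "glued n (?k \<circ> c) B \<in> \<L>"
            using inter[OF A(1)] A(2) inf_closed[OF S(3) As(3)[OF A(1)]] by simp
          show "2 \<le> card B"
          proof (cases "B \<in> set As")
            case True
            then show ?thesis using As by blast
          next
            case False
            then obtain w where "w \<in> R" "B = {v, w}" using B ws by auto
            moreover have "v \<noteq> w" using \<open>w \<in> R\<close> vR by auto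
            ultimately show ?thesis by simp
          qed
        qed
        show "glued n (?k \<circ> c) {} \<in> \<L>" using glued_contract[OF v] S by simp
        show "(\<exists>w. (?k \<circ> c) ` G \<subseteq> {w}) \<or> (?k \<circ> c) ` G = B"
          if B: "B \<in> set ?Bs" and G: "G \<in> \<G>" "(?k \<circ> c) ` G \<subseteq> B" for B G
        \<comment> \<open>A set \<open>B\<close> disjoint from \<open>S\<close> lacks
          \<open>v\<close>, so \<open>G\<close> avoids \<open>S\<close> and the contraction does not
          affect it. An edge has no proper subset with two labels.\<close>
        proof (cases "B \<in> set As \<and> B \<inter> S = {}")
          case True
          then have "v \<notin> B" using v by auto
          then have "c i \<notin> S" if "i \<in> G" for i using G(2) that by (auto simp: contract_def)
          then have "(?k \<circ> c) ` G = c ` G" by (auto simp: contract_def)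
          then show ?thesis using Cons.prems(6)[of B G] True G by auto
        next
          case False
          then obtain w where "B = {v, w}" using B by auto
          moreover have "(\<exists>z. X \<subseteq> {z}) \<or> X = {v, w}" if "X \<subseteq> {v, w}" for X
            using that by (cases "v \<in> X"; cases "w \<in> X") auto
          ultimately show ?thesis using G(2) by simp
        qed
      qed
      have "shelled ?b (insert ?a (glued n c ` set As))"
      proof (rule shelled.insert[OF sh cov fresh])
        show "shelled ?a (glued n (?k \<circ> c) ` set ?Bs)" using shB glued_contract[OF v] by simp
        show "glued n (?k \<circ> c) ` set ?Bs \<subseteq> meets ?b (insert ?a (glued n c ` set As))"
        proof
          fix x assume "x \<in> glued n (?k \<circ> c) ` set ?Bs"
          then obtain B where B: "B \<in> set ?Bs" "x = glued n (?k \<circ> c) B" by blast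
          obtain A where "A \<in> set As" "B = ?k ` A" using Bs[OF B(1)] by blast
          then have A: "A \<in> set As" "x = ?a \<inter> glued n c A" using inter B(2) by simp_all
          have "x = inf ?b (Inf {?a, glued n c A})"
            using A(2) glued_antimono[of "{}" S n c] by auto
          moreover have "{?a, glued n c A} \<subseteq> insert ?a (glued n c ` set As)" using A(1) by blast
          ultimately show "x \<in> meets ?b (insert ?a (glued n c ` set As))"
            unfolding meets_def by blast
        qed
        fix a' assume "a' \<in> glued n c ` set As"
        then obtain A where A: "A \<in> set As" "a' = glued n c A" by blast
        obtain B where B: "B \<in> set ?Bs" "B \<subseteq> ?k ` A" using ex[OF A(1)] by blast
        have "inf ?a a' \<subseteq> glued n (?k \<circ> c) B"
          using inter[OF A(1)] A(2) glued_antimono[OF B(2), of n "?k \<circ> c"] by simp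
        then show "\<exists>x\<in>glued n (?k \<circ> c) ` set ?Bs. inf ?a a' \<le> x" using B(1) by blast
      qed
      then show ?thesis by simp
    qed
  qed
qed

end

section \<open>From shellings of the complex to shelled arrangements\<close>

lemma proper_part_eq_inner_meets: "proper_part n \<Delta> = inner_meets (Rn n) (diag_arrangement n \<Delta>)"
  by (simp add: proper_part_def inner_meets_def intersection_lattice_def meets_def
      lattice_bot_def lattice_top_def)

text \<open>Enlarge the intersection of the facets \<open>i\<close> and \<open>k\<close> to a facet
  \<open>H\<close> of the intersection complex. Purity gives \<open>H\<close> codimension one in the
  facet \<open>k\<close>; some earlier facet \<open>j\<close> contains \<open>H\<close>, and
  maximality makes \<open>H\<close> its intersection with the facet \<open>k\<close>.\<close>

lemma intersect_facets_codim_1: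
  assumes fin: "finite (fs ! k)" and k: "k < length fs" and i: "i < k"
    and pure: "pure_of_dim ((\<Union>i<k. Pow (fs ! i)) \<inter> Pow (fs ! k)) (int (card (fs ! k)) - 1 - 1)"
  shows "\<exists>j<k. \<exists>w. w \<notin> fs ! i \<and> fs ! k - fs ! j = {w}"
proof -
  define I where "I = (\<Union>i<k. Pow (fs ! i)) \<inter> Pow (fs ! k)"
  have I: "G \<in> I \<longleftrightarrow> (\<exists>j<k. G \<subseteq> fs ! j) \<and> G \<subseteq> fs ! k" for G by (auto simp: I_def)
  have 1: "finite I" using fin by (simp add: I_def)
  have 2: "fs ! i \<inter> fs ! k \<in> I" using i by (auto simp: I)
  obtain H where H: "H \<in> I" "fs ! i \<inter> fs ! k \<subseteq> H" "\<forall>G\<in>I. H \<subseteq> G \<longrightarrow> H = G"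
    using finite_has_maximal2[OF 1 2] by blast
  then have "H \<in> facets I" by (auto simp: facets_def)
  then have c: "int (card H) = int (card (fs ! k)) - 1"
    using pure unfolding pure_of_dim_def I_def[symmetric] by fastforce
  obtain j where j: "j < k" "H \<subseteq> fs ! j" "H \<subseteq> fs ! k" using H(1) unfolding I by blast
  then have "fs ! j \<inter> fs ! k \<in> I" "H \<subseteq> fs ! j \<inter> fs ! k" unfolding I by auto
  then have eq: "H = fs ! j \<inter> fs ! k" using H(3) by blast
  have "card (fs ! k - H) = card (fs ! k) - card H"
    using j fin by (intro card_Diff_subset) (auto intro: finite_subset)
  then have "card (fs ! k - H) = 1" using c by simp
  then obtain w where w: "fs ! k - H = {w}" by (meson card_1_singletonE)
  then have "fs ! k - fs ! j = {w}" using eq by blast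
  moreover have "w \<notin> fs ! i" using w H(2) by blast
  ultimately show ?thesis using j by blast
qed

lemma linear_quotients_rev:
  assumes "\<And>k i. k < length As \<Longrightarrow> i < k \<Longrightarrow> \<exists>j<k. \<exists>w\<in>As ! i - As ! k. As ! j - As ! k = {w}"
  shows "linear_quotients (rev As)"
  using assms
proof (induction As rule: rev_induct)
  case Nil
  then show ?case by simp
next
  case (snoc S As)
  have "linear_quotients (rev As)"
  proof (rule snoc.IH)
    fix k i assume ki: "k < length As" "i < k"
    then show "\<exists>j<k. \<exists>w\<in>As ! i - As ! k. As ! j - As ! k = {w}"
      using snoc.prems[of k i] by (auto simp: nth_append)
  qed
  moreover have "\<exists>B\<in>set As. \<exists>w\<in>A - S. B - S = {w}" if A: "A \<in> set As" for A
  proof -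
    obtain i where i: "i < length As" "A = As ! i" using A by (metis in_set_conv_nth)
    obtain j w where "j < length As" "w \<in> A - S" "As ! j - S = {w}"
      using snoc.prems[of "length As" i] i by (auto simp: nth_append)
    then show ?thesis using nth_mem by blast
  qed
  ultimately show ?case by simp
qed

text \<open>Complements reverse differences, so the exchange property of the facets becomes the
  linear quotient condition. The dimension bound gives each complement at least two elements, and
  the complements of facets form an antichain.\<close>

theorem shellable_imp_shelled_arrangement:
  assumes sc: "simplicial_complex_on n \<Delta>" and sh: "shellable \<Delta>" and dim: "cx_dim_le \<Delta> (int n - 3)"
  shows "finite_meet_semilattice.shelled (intersection_lattice n \<Delta>) (Rn n) (diag_arrangement n \<Delta>)"
proof -
  define \<G> where "\<G> = (\<lambda>F. {1..n} - F) ` facets \<Delta>"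
  interpret diagonal_lattice n \<G> by unfold_locales (auto simp: \<G>_def)
  have arr: "diag_arrangement n \<Delta> = diag_subspace n ` \<G>"
    by (auto simp: diag_arrangement_def \<G>_def)
  have lat: "intersection_lattice n \<Delta> = \<L>"
    by (auto simp: intersection_lattice_def meets_def arr)
  obtain fs where fs: "distinct fs" "set fs = facets \<Delta>"
    "\<And>k. 1 \<le> k \<Longrightarrow> k < length fs \<Longrightarrow>
        pure_of_dim ((\<Union>i<k. Pow (fs ! i)) \<inter> Pow (fs ! k)) (int (card (fs ! k)) - 1 - 1)"
    using sh unfolding shellable_def by blast
  have sub: "F \<subseteq> {1..n}" if "F \<in> \<Delta>" for F
    using sc that unfolding simplicial_complex_on_def by blast
  then have fin: "finite F" if "F \<in> \<Delta>" for F using that finite_subset by blast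
  have "\<Delta> \<subseteq> Pow {1..n}" using sub by blast
  then have "finite \<Delta>" by (rule finite_subset) simp
  moreover have "\<Delta> \<noteq> {}" using sc unfolding simplicial_complex_on_def by blast
  ultimately obtain F0 where "F0 \<in> \<Delta>" "\<forall>G\<in>\<Delta>. F0 \<subseteq> G \<longrightarrow> F0 = G"
    using finite_has_maximal[of \<Delta>] by blast
  then have "F0 \<in> facets \<Delta>" by (auto simp: facets_def)
  then have ne: "fs \<noteq> []" using fs(2) by auto
  have fD: "F \<in> \<Delta>" if "F \<in> set fs" for F using that fs by (auto simp: facets_def)
  have fsub: "F \<subseteq> {1..n}" if "F \<in> set fs" for F using that fD sub by blast
  define As where "As = map (\<lambda>F. {1..n} - F) fs"
  have nthA: "As ! k = {1..n} - fs ! k" if "k < length fs" for k using that by (simp add: As_def)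
  have lq: "linear_quotients (rev As)"
  proof (rule linear_quotients_rev)
    fix k i assume ki: "k < length As" "i < k"
    then have ki': "k < length fs" "i < length fs" by (auto simp: As_def)
    have "finite (fs ! k)" using fin fD ki' by simp
    then obtain j w where j: "j < k" "w \<notin> fs ! i" "fs ! k - fs ! j = {w}"
      using intersect_facets_codim_1[OF _ ki'(1) ki(2) fs(3)[OF _ ki'(1)]] ki(2) by auto
    have "fs ! k \<subseteq> {1..n}" "fs ! j \<subseteq> {1..n}" using fsub ki' j by auto
    then have "As ! j - As ! k = {w}" "w \<in> As ! i - As ! k"
      using j ki' nthA[of j] nthA[of k] nthA[of i] by auto
    then show "\<exists>j<k. \<exists>w\<in>As ! i - As ! k. As ! j - As ! k = {w}" using j by blast
  qed
  have inj: "inj_on (\<lambda>F. {1..n} - F) (set fs)"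
    using fsub by (auto simp: inj_on_def)
  have setA: "set (rev As) = \<G>" by (simp add: As_def \<G>_def fs)
  have card2: "2 \<le> card A" if AG: "A \<in> \<G>" for A
  proof -
    obtain F where F: "F \<in> facets \<Delta>" "A = {1..n} - F" using AG by (auto simp: \<G>_def)
    then have FD: "F \<in> \<Delta>" by (auto simp: facets_def)
    then have "int (card F) - 1 \<le> int n - 3" using dim by (auto simp: cx_dim_le_def)
    moreover have "card A = n - card F" using F sub[OF FD] fin[OF FD] by (simp add: card_Diff_subset)
    ultimately show ?thesis by linarith
  qed
  have "shelled (glued n id {}) (glued n id ` set (rev As))"
  proof (rule shelled_glued[OF lq])
    show "rev As \<noteq> []" using ne by (simp add: As_def)
    show "distinct (rev As)" using inj fs by (simp add: As_def distinct_map)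
    show "A \<subseteq> id ` {1..n} \<and> 2 \<le> card A \<and> glued n id A \<in> \<L>" if A: "A \<in> set (rev As)" for A
    proof -
      have AG: "A \<in> \<G>" using A setA by simp
      have "diag_subspace n A \<in> \<L>"
        using AG by (intro gen_in_meets) (auto simp: diag_subspace_def)
      then show ?thesis using AG \<G>_subset[OF AG] card2[OF AG] diag_subspace_eq_glued by simp
    qed
    show "glued n id {} \<in> \<L>" using base_in_meets Rn_eq_glued by metis
    fix A G assume AG: "A \<in> set (rev As)" "G \<in> \<G>" "id ` G \<subseteq> A"
    obtain F F' where "F \<in> facets \<Delta>" "A = {1..n} - F" "F' \<in> facets \<Delta>" "G = {1..n} - F'"
      using AG setA by (auto simp: \<G>_def)
    moreover have "F \<subseteq> F'" using calculation AG(3) fsub fs(2) by auto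
    ultimately have "G = A" by (auto simp: facets_def)
    then show "(\<exists>w. id ` G \<subseteq> {w}) \<or> id ` G = A" by simp
  qed
  moreover have "glued n id ` \<G> = diag_subspace n ` \<G>"
    using diag_subspace_eq_glued \<G>_subset by (intro image_cong) auto
  ultimately show ?thesis using setA arr lat Rn_eq_glued by metis
qed

section \<open>Collapses\<close>

lemma homotopic_canonI:
  assumes "continuous_on ({0..1::real} \<times> S) h" "h ` ({0..1} \<times> S) \<subseteq> T"
    and "\<And>x. x \<in> S \<Longrightarrow> h (0, x) = f x" "\<And>x. x \<in> S \<Longrightarrow> h (1, x) = g x"
  shows "homotopic_with_canon (\<lambda>_. True) S T f g"
proof -
  have "continuous_map (top_of_set ({0..1} \<times> S)) (top_of_set T) h"
    using assms by (auto simp: continuous_map_subtopology_eu)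
  then show ?thesis using assms(3,4) by (auto simp: homotopic_with)
qed

lemma Hausdorff_space_real_functions: "Hausdorff_space (top_of_set (S :: ('a \<Rightarrow> real) set))"
proof -
  have "Hausdorff_space (euclidean :: ('a \<Rightarrow> real) topology)"
    by (simp add: Hausdorff_space_product_topology flip: euclidean_product_topology)
  then show ?thesis by (rule Hausdorff_space_subtopology)
qed

text \<open>The classical fact that collapsing a contractible \<open>A\<close> with an extended
  contraction \<open>G\<close> is a homotopy equivalence. The inverse is induced by \<open>G\<close>
  at time 1, which is constant on \<open>A\<close>; the homotopy on \<open>W\<close> exists because
  \<open>G\<close> keeps \<open>A\<close> inside \<open>A\<close>. Both are continuous since
  surjections from compact to Hausdorff spaces are quotient maps.\<close>

lemma homotopy_equivalent_collapse:
  fixes X :: "('a \<Rightarrow> real) set" and \<phi> :: "('a \<Rightarrow> real) \<Rightarrow> 'b \<Rightarrow> real"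
  assumes X: "compact X" and \<phi>: "continuous_on X \<phi>" "\<phi> ` X = W"
    and A: "A \<subseteq> X" "\<And>x y. x \<in> X \<Longrightarrow> y \<in> X \<Longrightarrow> \<phi> x = \<phi> y \<Longrightarrow> x = y \<or> x \<in> A \<and> y \<in> A"
      "\<And>x y. x \<in> A \<Longrightarrow> y \<in> A \<Longrightarrow> \<phi> x = \<phi> y"
    and G: "continuous_on ({0..1::real} \<times> X) G" "G ` ({0..1} \<times> X) \<subseteq> X" "G ` ({0..1} \<times> A) \<subseteq> A"
      "\<And>x. x \<in> X \<Longrightarrow> G (0, x) = x" "\<And>x. x \<in> A \<Longrightarrow> G (1, x) = a"
  shows "top_of_set X homotopy_equivalent_space top_of_set W"
proof -
  \<comment> \<open>In general a discontinuous section; it occurs only in composites that do not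
    depend on the choice of a point in \<open>A\<close>.\<close>
  define \<sigma> where "\<sigma> = inv_into X \<phi>"
  have \<sigma>: "\<sigma> w \<in> X" "\<phi> (\<sigma> w) = w" if "w \<in> W" for w
    using that \<phi>(2) inv_into_into f_inv_into_f unfolding \<sigma>_def by metis+
  have \<sigma>\<phi>: "\<sigma> (\<phi> x) = x \<or> \<sigma> (\<phi> x) \<in> A \<and> x \<in> A" if "x \<in> X" for x
    using A(2)[of "\<sigma> (\<phi> x)" x] \<sigma>[of "\<phi> x"] \<phi>(2) that by auto
  have mem: "G (t, x) \<in> X" if "t \<in> {0..1}" "x \<in> X" for t x using G(2) that by blast
  have memA: "G (t, x) \<in> A" if "t \<in> {0..1}" "x \<in> A" for t x using G(3) that by blast
  define \<psi> where "\<psi> = (\<lambda>w. G (1, \<sigma> w))"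
  have \<psi>\<phi>: "\<psi> (\<phi> x) = G (1, x)" if "x \<in> X" for x
    using \<sigma>\<phi>[OF that] G(5) by (auto simp: \<psi>_def)
  have q: "quotient_map (top_of_set X) (top_of_set W) \<phi>"
    using X \<phi> by (intro continuous_imp_quotient_map Hausdorff_space_real_functions)
      (auto simp: continuous_map_subtopology_eu compact_space_subtopology)
  have G1: "continuous_on X (\<lambda>x. G (1, x))"
    by (rule continuous_on_compose2[OF G(1)]) (auto intro!: continuous_intros)
  have "continuous_map (top_of_set X) (top_of_set X) (\<psi> \<circ> \<phi>)"
    using G1 mem \<psi>\<phi> by (auto simp: continuous_map_subtopology_eu cong: continuous_on_cong)
  then have \<psi>: "continuous_map (top_of_set W) (top_of_set X) \<psi>"
    by (rule continuous_compose_quotient_map[OF q])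
  have 1: "homotopic_with_canon (\<lambda>_. True) X X id (\<psi> \<circ> \<phi>)"
    using G(1,2,4) \<psi>\<phi> by (intro homotopic_canonI[of X G]) auto
  define F where "F = (\<lambda>(t::real, w). \<phi> (G (t, \<sigma> w)))"
  have F\<phi>: "F (t, \<phi> x) = \<phi> (G (t, x))" if "t \<in> {0..1}" "x \<in> X" for t x
    using \<sigma>\<phi>[OF that(2)] A(3) memA[OF that(1)] by (auto simp: F_def)
  define \<Phi> where "\<Phi> = (\<lambda>(t::real, x). (t, \<phi> x))"
  have "continuous_on ({0..1} \<times> X) \<Phi>"
    unfolding \<Phi>_def case_prod_unfold
    by (intro continuous_intros continuous_on_compose2[OF \<phi>(1)]) auto
  moreover have "\<Phi> ` ({0..1} \<times> X) = {0..1} \<times> W"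
    using \<phi>(2) by (auto simp: \<Phi>_def image_iff)
  moreover have "Hausdorff_space (top_of_set ({0..1::real} \<times> W))"
    using Hausdorff_space_real_functions[of W] Hausdorff_space_subtopology[of euclideanreal "{0..1}"]
    by (simp add: Hausdorff_space_prod_topology flip: prod_topology_subtopology_eu)
  ultimately have Q: "quotient_map (top_of_set ({0..1} \<times> X)) (top_of_set ({0..1} \<times> W)) \<Phi>"
    using X by (intro continuous_imp_quotient_map)
      (auto simp: continuous_map_subtopology_eu compact_space_subtopology compact_Times)
  have FPhi: "(F \<circ> \<Phi>) p = \<phi> (G p)" if "p \<in> {0..1} \<times> X" for p
    using that F\<phi> by (auto simp: \<Phi>_def)
  have "continuous_on ({0..1} \<times> X) (\<lambda>p. \<phi> (G p))"
    by (rule continuous_on_compose2[OF \<phi>(1) G(1)]) (use G(2) in auto)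
  then have "continuous_on ({0..1} \<times> X) (F \<circ> \<Phi>)"
    using FPhi by (simp cong: continuous_on_cong)
  moreover have "(F \<circ> \<Phi>) p \<in> W" if "p \<in> {0..1} \<times> X" for p
    using FPhi[OF that] G(2) \<phi>(2) that by blast
  then have "(F \<circ> \<Phi>) ` ({0..1} \<times> X) \<subseteq> W" by blast
  ultimately have "continuous_map (top_of_set ({0..1} \<times> X)) (top_of_set W) (F \<circ> \<Phi>)"
    by (auto simp: continuous_map_subtopology_eu)
  then have Fc: "continuous_map (top_of_set ({0..1} \<times> W)) (top_of_set W) F"
    by (rule continuous_compose_quotient_map[OF Q])
  have 2: "homotopic_with_canon (\<lambda>_. True) W W id (\<phi> \<circ> \<psi>)"
  proof (rule homotopic_canonI[of W F])
    show "continuous_on ({0..1} \<times> W) F" "F ` ({0..1} \<times> W) \<subseteq> W"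
      using Fc by (auto simp: continuous_map_subtopology_eu)
    show "F (0, w) = id w" if "w \<in> W" for w using \<sigma>[OF that] G(4) by (simp add: F_def)
    show "F (1, w) = (\<phi> \<circ> \<psi>) w" if "w \<in> W" for w by (simp add: F_def \<psi>_def)
  qed
  show ?thesis
    unfolding homotopy_equivalent_space_def
    using \<phi> \<psi> homotopic_with_symD[OF 1] homotopic_with_symD[OF 2]
    by (intro exI[of _ \<phi>] exI[of _ \<psi>]) (auto simp: continuous_map_subtopology_eu)
qed

section \<open>Collapses of geometric realizations\<close>

abbreviation support :: "('a \<Rightarrow> real) \<Rightarrow> 'a set" where
  "support x \<equiv> {v. x v \<noteq> 0}"

definition min_coord :: "'a set \<Rightarrow> ('a \<Rightarrow> real) \<Rightarrow> real" where
  "min_coord C x = Min (x ` C)"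

lemma continuous_on_coord [continuous_intros]: "continuous_on S (\<lambda>x::'a \<Rightarrow> real. x v)"
  by (rule continuous_on_subset[OF continuous_on_product_coordinates]) auto

lemma continuous_on_min_coord:
  assumes "finite C" "C \<noteq> {}"
  shows "continuous_on S (min_coord C)"
  using assms
proof (induction rule: finite_ne_induct)
  case (singleton v)
  then show ?case by (simp add: min_coord_def continuous_on_coord)
next
  case (insert v C)
  have "min_coord (insert v C) = (\<lambda>x. min (x v) (min_coord C x))"
    using insert by (intro ext) (simp add: min_coord_def)
  then show ?case using insert by (simp only:) (intro continuous_intros)
qed

lemma min_coord_le: "finite C \<Longrightarrow> v \<in> C \<Longrightarrow> min_coord C x \<le> x v"
  by (simp add: min_coord_def)

lemma min_coord_attained: "finite C \<Longrightarrow> C \<noteq> {} \<Longrightarrow> \<exists>v\<in>C. min_coord C x = x v"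
proof -
  assume "finite C" "C \<noteq> {}"
  then have "Min (x ` C) \<in> x ` C" by (intro Min_in) auto
  then show ?thesis by (auto simp: min_coord_def)
qed

definition subset_closed :: "'a set set \<Rightarrow> bool" where
  "subset_closed K \<longleftrightarrow> (\<forall>F\<in>K. \<forall>G. G \<subseteq> F \<longrightarrow> G \<in> K)"

lemma subset_closedD: "subset_closed K \<Longrightarrow> F \<in> K \<Longrightarrow> G \<subseteq> F \<Longrightarrow> G \<in> K"
  by (auto simp: subset_closed_def)

lemma geom_realizationD:
  assumes "x \<in> geom_realization V K"
  shows "0 \<le> x v" "v \<notin> V \<Longrightarrow> x v = 0" "sum x V = 1" "support x \<in> K" "support x \<subseteq> V"
  using assms by (auto simp: geom_realization_def)

lemma geom_realization_mono: "K \<subseteq> L \<Longrightarrow> geom_realization V K \<subseteq> geom_realization V L"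
  by (auto simp: geom_realization_def)

lemma min_coord_pos_iff:
  assumes "x \<in> geom_realization V K" "finite C" "C \<noteq> {}"
  shows "0 < min_coord C x \<longleftrightarrow> C \<subseteq> support x" "0 \<le> min_coord C x"
proof -
  obtain u where u: "u \<in> C" "min_coord C x = x u" using min_coord_attained assms by metis
  then show "0 \<le> min_coord C x" using geom_realizationD(1)[OF assms(1)] by simp
  show "0 < min_coord C x \<longleftrightarrow> C \<subseteq> support x"
  proof
    assume pos: "0 < min_coord C x"
    show "C \<subseteq> support x"
    proof
      fix v assume "v \<in> C"
      then have "0 < x v" using pos min_coord_le[OF assms(2), of v x] by linarith
      then show "v \<in> support x" by simp
    qed
  next
    assume "C \<subseteq> support x"
    then have "x u \<noteq> 0" using u by blast
    then show "0 < min_coord C x" using u geom_realizationD(1)[OF assms(1), of u] by linarith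
  qed
qed

text \<open>Weight flows from the vertices of the free face \<open>\<sigma>\<close> to
  \<open>v\<close>, at equal speed, until a coordinate in \<open>\<sigma>\<close> vanishes. The
  least coordinate measures how far to go and is 0 on the realization of \<open>K\<close>, which is
  therefore fixed.\<close>

lemma elementary_collapse:
  fixes K :: "'a set set"
  assumes V: "finite V" "insert v \<sigma> \<subseteq> V" and K: "subset_closed K"
    and \<sigma>: "\<sigma> \<noteq> {}" "v \<notin> \<sigma>" "\<sigma> \<notin> K" "\<And>t. t \<in> \<sigma> \<Longrightarrow> insert v \<sigma> - {t} \<in> K"
  shows "top_of_set (geom_realization V (K \<union> {\<sigma>, insert v \<sigma>}))
    homotopy_equivalent_space top_of_set (geom_realization V K)"
proof -
  let ?L = "K \<union> {\<sigma>, insert v \<sigma>}"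
  let ?X = "geom_realization V ?L" and ?Y = "geom_realization V K"
  have fin: "finite \<sigma>" using V finite_subset by auto
  \<comment> \<open>Each vertex of \<open>\<sigma>\<close> loses one unit and \<open>v\<close> gains
    them all, so the coordinates still sum to 1.\<close>
  define e :: "'a \<Rightarrow> real" where "e u = (if u = v then real (card \<sigma>) else if u \<in> \<sigma> then - 1 else 0)" for u
  define h where "h = (\<lambda>(s::real, x::'a \<Rightarrow> real) u. x u + s * min_coord \<sigma> x * e u)"
  have sum_e: "sum e V = 0"
  proof -
    have "sum e V = sum e (insert v \<sigma>)"
      using V by (intro sum.mono_neutral_right) (auto simp: e_def)
    also have "\<dots> = e v + sum e \<sigma>" using fin \<sigma> by simp
    also have "sum e \<sigma> = (\<Sum>u\<in>\<sigma>. - 1)" using \<sigma> by (intro sum.cong) (auto simp: e_def)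
    finally show ?thesis by (simp add: e_def)
  qed
  have sub: "G \<in> ?L" if "G \<subseteq> insert v \<sigma>" for G
  proof (cases "\<sigma> \<subseteq> G")
    case True
    then show ?thesis using that by (metis UnCI insertCI subset_antisym subset_insert insert_subset insertI1)
  next
    case False
    then obtain t where "t \<in> \<sigma>" "t \<notin> G" by blast
    then show ?thesis using that subset_closedD[OF K \<sigma>(4)] by blast
  qed
  have m0: "min_coord \<sigma> x = 0" if "x \<in> ?Y" for x
  proof -
    have "\<not> \<sigma> \<subseteq> support x" using subset_closedD[OF K] geom_realizationD(4)[OF that] \<sigma>(3) by blast
    then show ?thesis using min_coord_pos_iff[OF that fin \<sigma>(1)] by linarith
  qed
  have hX: "h (s, x) \<in> ?X" if x: "x \<in> ?X" and s: "s \<in> {0..1}" for s x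
  proof (cases "min_coord \<sigma> x = 0")
    case True
    then show ?thesis using x by (simp add: h_def)
  next
    case False
    then have pos: "0 < min_coord \<sigma> x" using min_coord_pos_iff(2)[OF x fin \<sigma>(1)] by linarith
    then have "\<sigma> \<subseteq> support x" using min_coord_pos_iff[OF x fin \<sigma>(1)] by blast
    then have "support x \<notin> K" using subset_closedD[OF K] \<sigma>(3) by blast
    then have supp: "support x \<subseteq> insert v \<sigma>" using geom_realizationD(4)[OF x] by auto
    have nonneg: "0 \<le> h (s, x) u" for u
    proof -
      have x0: "0 \<le> x u" by (rule geom_realizationD(1)[OF x])
      consider "u = v" | "u \<noteq> v" "u \<in> \<sigma>" | "u \<noteq> v" "u \<notin> \<sigma>" by blast
      then show ?thesis
      proof cases
        case 2
        have "s * min_coord \<sigma> x \<le> 1 * min_coord \<sigma> x" using s pos by (intro mult_right_mono) auto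
        also have "\<dots> \<le> x u" using min_coord_le[OF fin 2(2)] by simp
        finally show ?thesis using 2 by (simp add: h_def e_def)
      qed (use x0 s pos in \<open>auto simp: h_def e_def\<close>)
    qed
    have zero: "h (s, x) u = 0" if "u \<notin> insert v \<sigma>" for u
      using that supp by (auto simp: h_def e_def)
    have "sum (h (s, x)) V = sum x V + s * min_coord \<sigma> x * sum e V"
      by (simp add: h_def sum.distrib sum_distrib_left)
    then have "sum (h (s, x)) V = 1" using sum_e geom_realizationD(3)[OF x] by simp
    moreover have "support (h (s, x)) \<in> ?L" using zero by (intro sub) blast
    ultimately show ?thesis using nonneg zero V unfolding geom_realization_def by blast
  qed
  have hY: "h (1, x) \<in> ?Y" if x: "x \<in> ?X" for x
  proof (cases "support x \<in> K")
    case True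
    then have "x \<in> ?Y" using x by (auto simp: geom_realization_def)
    then show ?thesis using m0 by (simp add: h_def)
  next
    case False
    then have supp: "support x \<subseteq> insert v \<sigma>" using geom_realizationD(4)[OF x] by auto
    obtain t where t: "t \<in> \<sigma>" "min_coord \<sigma> x = x t" using min_coord_attained fin \<sigma>(1) by metis
    have "h (1, x) t = 0" using t \<sigma>(2) by (auto simp: h_def e_def)
    moreover have "h (1, x) u = 0" if "u \<notin> insert v \<sigma>" for u
      using that supp by (auto simp: h_def e_def)
    ultimately have "support (h (1, x)) \<subseteq> insert v \<sigma> - {t}" by blast
    then have "support (h (1, x)) \<in> K" by (rule subset_closedD[OF K \<sigma>(4)[OF t(1)]])
    then show ?thesis using hX[OF x, of 1] by (simp add: geom_realization_def)
  qed
  have hid: "h (s, x) = x" if "x \<in> ?Y" for s x using m0[OF that] by (simp add: h_def)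
  have cont: "continuous_on T h" for T
  proof -
    have c1: "continuous_on T (\<lambda>p. snd p u)" for u
      by (rule continuous_on_compose2[OF continuous_on_coord[of UNIV u] continuous_on_snd[OF continuous_on_id]]) auto
    have c2: "continuous_on T (\<lambda>p. min_coord \<sigma> (snd p))"
      by (rule continuous_on_compose2[OF continuous_on_min_coord[OF fin \<sigma>(1), of UNIV] continuous_on_snd[OF continuous_on_id]]) auto
    show ?thesis
      unfolding h_def case_prod_unfold
      by (intro continuous_on_coordinatewise_then_product continuous_on_add continuous_on_mult
          continuous_on_fst continuous_on_id continuous_on_const c1 c2)
  qed
  have YX: "?Y \<subseteq> ?X" by (intro geom_realization_mono) auto
  show ?thesis
  proof (rule deformation_retraction_imp_homotopy_equivalent_space)
    have "homotopic_with_canon (\<lambda>_. True) ?X ?X id (id \<circ> (\<lambda>x. h (1, x)))"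
      using hX by (intro homotopic_canonI[of ?X h] cont) (auto simp: h_def)
    then show "homotopic_with_canon (\<lambda>_. True) ?X ?X (id \<circ> (\<lambda>x. h (1, x))) id"
      by (rule homotopic_with_symD)
    have "continuous_on ?X (\<lambda>x. h (1, x))"
      by (rule continuous_on_compose2[OF cont[of UNIV]]) (auto intro!: continuous_intros)
    then show "retraction_maps (top_of_set ?X) (top_of_set ?Y) (\<lambda>x. h (1, x)) id"
      using hY hid YX by (auto simp: retraction_maps_def continuous_map_subtopology_eu)
  qed
qed

lemma nonevasive_complex:
  assumes "nonevasive K"
  shows "subset_closed K" "{} \<in> K" "K \<noteq> {{}}"
proof -
  have "subset_closed K \<and> {} \<in> K \<and> K \<noteq> {{}}"
    using assms
  proof (induction rule: nonevasive.induct)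
    case (point x)
    then show ?case by (auto simp: subset_closed_def subset_singleton_iff)
  next
    case (attach K J x)
    have "G \<in> K \<union> insert x ` J" if "F \<in> J" "G \<subseteq> insert x F" for F G
    proof (cases "x \<in> G")
      case True
      have "G - {x} \<subseteq> F" using that by auto
      then have "G - {x} \<in> J" using attach.IH(2) that(1) subset_closedD by metis
      then show ?thesis using True by (metis UnCI image_eqI insert_Diff)
    next
      case False
      then have "G \<subseteq> F" using that by auto
      then have "G \<in> J" using attach.IH(2) that(1) subset_closedD by metis
      then show ?thesis using attach.hyps(3) by auto
    qed
    then have "subset_closed (K \<union> insert x ` J)"
      using attach.IH(1) unfolding subset_closed_def by blast
    then show ?case using attach.IH(1) by auto
  qed
  then show "subset_closed K" "{} \<in> K" "K \<noteq> {{}}" by auto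
qed

text \<open>Attaching \<open>T * J\<close> along \<open>\<partial>T * J\<close>: collapsing the faces \<open>T \<union> \<rho>\<close> in pairs, in the order given
  by the construction of \<open>J\<close>.\<close>
lemma nonevasive_join_collapse:
  assumes "nonevasive J" "finite V" "subset_closed K" "T \<noteq> {}" "T \<union> \<Union>J \<subseteq> V" "T \<inter> \<Union>J = {}"
    and "\<And>t \<rho>. t \<in> T \<Longrightarrow> \<rho> \<in> J \<Longrightarrow> (T - {t}) \<union> \<rho> \<in> K" "\<And>\<rho>. \<rho> \<in> J \<Longrightarrow> T \<union> \<rho> \<notin> K"
  shows "top_of_set (geom_realization V (K \<union> (\<union>) T ` J)) homotopy_equivalent_space
    top_of_set (geom_realization V K)"
  using assms
proof (induction arbitrary: K T rule: nonevasive.induct)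
  case (point y)
  have y: "y \<notin> T" using point.prems(5) by auto
  have "insert y T - {t} \<in> K" if "t \<in> T" for t
  proof -
    have "insert y T - {t} = T - {t} \<union> {y}" using that y by auto
    then show ?thesis using point.prems(6)[OF that, of "{y}"] by simp
  qed
  moreover have "T \<notin> K" using point.prems(7)[of "{}"] by simp
  moreover have "(\<union>) T ` {{}, {y}} = {T, insert y T}" by auto
  ultimately show ?case
    using elementary_collapse[of V y T K] point.prems y by auto
next
  case (attach J1 J2 y)
  let ?K' = "K \<union> (\<union>) T ` J1"
  have yT: "y \<notin> T" 
  proof -
    have "{} \<in> J2" using nonevasive_complex(2)[OF attach.hyps(2)] .
    then have "y \<in> \<Union>(J1 \<union> insert y ` J2)" by auto
    then show ?thesis using attach.prems(5) by blast
  qed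
  have J1: "J1 \<subseteq> J1 \<union> insert y ` J2" and J2: "\<rho> \<in> J2 \<Longrightarrow> insert y \<rho> \<in> J1 \<union> insert y ` J2" for \<rho> by auto
  have sc1: "subset_closed J1" "subset_closed J2" using nonevasive_complex attach.hyps by auto
  \<comment> \<open>The new faces through \<open>y\<close> are the join of \<open>insert y T\<close>
    with \<open>J2\<close>. They are collapsed before those over \<open>J1\<close>, with
    \<open>y\<close> counted as a vertex of the simplex.\<close>
  have eq: "K \<union> (\<union>) T ` (J1 \<union> insert y ` J2) = ?K' \<union> (\<union>) (insert y T) ` J2"
    by (auto simp: image_Un image_image)
  have closed': "subset_closed ?K'"
    unfolding subset_closed_def
  proof (intro ballI allI impI)
    fix F G assume F: "F \<in> ?K'" and G: "G \<subseteq> F"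
    show "G \<in> ?K'"
    proof (cases "F \<in> K")
      case True
      then show ?thesis using G subset_closedD[OF attach.prems(2)] by blast
    next
      case False
      then obtain \<rho> where r: "\<rho> \<in> J1" "F = T \<union> \<rho>" using F by auto
      show ?thesis
      proof (cases "T \<subseteq> G")
        case True
        then have "G = T \<union> (G \<inter> \<rho>)" using G r by auto
        moreover have "G \<inter> \<rho> \<in> J1" using subset_closedD[OF sc1(1) r(1)] by auto
        ultimately show ?thesis by blast
      next
        case False
        then obtain t where t: "t \<in> T" "t \<notin> G" by auto
        then have "G \<subseteq> (T - {t}) \<union> \<rho>" using G r by auto
        moreover have "(T - {t}) \<union> \<rho> \<in> K" using attach.prems(6) t r by blast
        ultimately show ?thesis using subset_closedD[OF attach.prems(2)] by blast
      qed
    qed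
  qed
  have "top_of_set (geom_realization V (?K' \<union> (\<union>) (insert y T) ` J2)) homotopy_equivalent_space
    top_of_set (geom_realization V ?K')"
  proof (rule attach.IH(2)[OF attach.prems(1) closed'])
    show "insert y T \<noteq> {}" by simp
    have "y \<in> \<Union>(J1 \<union> insert y ` J2)" using nonevasive_complex(2)[OF attach.hyps(2)] by auto
    moreover have "\<Union>J2 \<subseteq> \<Union>(J1 \<union> insert y ` J2)" using attach.hyps(3) by auto
    ultimately show "insert y T \<union> \<Union>J2 \<subseteq> V" using attach.prems(4) by blast
    have "T \<inter> \<Union>J2 = {}" using attach.prems(5) attach.hyps(3) by auto
    moreover have "y \<notin> \<Union>J2" using attach.hyps(3,4) by auto
    ultimately show "insert y T \<inter> \<Union>J2 = {}" by auto
    show "insert y T - {t} \<union> \<rho> \<in> ?K'" if "t \<in> insert y T" "\<rho> \<in> J2" for t \<rho>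
    proof (cases "t = y")
      case True
      then show ?thesis using that yT attach.hyps(3) by auto
    next
      case False
      then have "t \<in> T" using that by auto
      then have "T - {t} \<union> insert y \<rho> \<in> K" using attach.prems(6)[OF _ J2[OF that(2)]] by blast
      moreover have "insert y T - {t} \<union> \<rho> = T - {t} \<union> insert y \<rho>" using False by auto
      ultimately show ?thesis by simp
    qed
    show "insert y T \<union> \<rho> \<notin> ?K'" if "\<rho> \<in> J2" for \<rho>
    proof
      assume "insert y T \<union> \<rho> \<in> ?K'"
      moreover have "T \<union> insert y \<rho> \<notin> K" using attach.prems(7)[OF J2[OF that]] .
      ultimately obtain \<rho>' where "\<rho>' \<in> J1" "insert y T \<union> \<rho> = T \<union> \<rho>'" by auto
      then have "y \<in> \<rho>'" using yT by blast
      then show False using attach.hyps(4) \<open>\<rho>' \<in> J1\<close> by blast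
    qed
  qed
  moreover have "top_of_set (geom_realization V ?K') homotopy_equivalent_space
    top_of_set (geom_realization V K)"
  proof (rule attach.IH(1)[OF attach.prems(1,2,3)])
    show "T \<union> \<Union>J1 \<subseteq> V" "T \<inter> \<Union>J1 = {}" using attach.prems(4,5) by auto
  qed (use attach.prems(6,7) in auto)
  ultimately show ?case unfolding eq by (rule homotopy_eqv_trans)
qed

text \<open>Adding a vertex \<open>x\<close> with link \<open>J\<close> is the join with the simplex
  \<open>T = {x}\<close>, whose only proper face is empty; the required faces are then those of
  \<open>J\<close>, which lie in \<open>K\<close>.\<close>

lemma nonevasive_contractible:
  assumes "nonevasive K" "finite V" "\<Union>K \<subseteq> V"
  shows "contractible_space (top_of_set (geom_realization V K))"
  using assms
proof (induction rule: nonevasive.induct)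
  case (point x)
  have "geom_realization V {{}, {x}} \<subseteq> {\<lambda>v. if v = x then 1 else 0}"
  proof
    fix y assume y: "y \<in> geom_realization V {{}, {x}}"
    have "support y \<subseteq> {x}" using geom_realizationD(4)[OF y] by auto
    moreover have "sum y V = sum y {x}"
      using calculation point by (intro sum.mono_neutral_right) auto
    ultimately have "y v = (if v = x then 1 else 0)" for v
      using geom_realizationD(3)[OF y] by auto
    then show "y \<in> {\<lambda>v. if v = x then 1 else 0}" by auto
  qed
  then consider "geom_realization V {{}, {x}} = {}" | a where "geom_realization V {{}, {x}} = {a}"
    by (meson subset_singletonD)
  then show ?case
  proof cases
    case 2
    then show ?thesis using contractible_space_subtopology_singleton by metis
  qed simp
next
  case (attach K J x)
  have "top_of_set (geom_realization V (K \<union> (\<union>) {x} ` J)) homotopy_equivalent_space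
    top_of_set (geom_realization V K)"
  proof (rule nonevasive_join_collapse[OF attach.hyps(2) attach.prems(1)])
    show "subset_closed K" using nonevasive_complex attach.hyps by blast
    show "{x} \<union> \<Union>J \<subseteq> V" using attach.prems(2) attach.hyps(3) nonevasive_complex(2)[OF attach.hyps(2)] by auto
  qed (use attach.hyps in auto)
  moreover have "(\<union>) {x} ` J = insert x ` J" by auto
  moreover have "contractible_space (top_of_set (geom_realization V K))"
    using attach.IH(1) attach.prems by blast
  ultimately show ?case by (metis homotopy_equivalent_space_contractibility)
qed

section \<open>Simplices and spheres\<close>

text \<open>The vertex type may be infinite, so compactness comes from Tychonoff's theorem for the
  cube that contains the simplex.\<close>

lemma compact_simplex:
  assumes "finite V" "C \<subseteq> V"
  shows "compact (geom_realization V (Pow C))" "closed (geom_realization V (Pow C))"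
proof -
  have eq: "geom_realization V (Pow C) =
      {x. \<forall>v. 0 \<le> x v} \<inter> {x. \<forall>v. v \<notin> C \<longrightarrow> x v = 0} \<inter> {x. sum x V = 1}"
    using assms(2) by (auto simp: geom_realization_def)
  have 1: "closed {x::'a \<Rightarrow> real. \<forall>v. 0 \<le> x v}"
    by (intro closed_Collect_all closed_Collect_le continuous_on_const continuous_on_coord)
  have 2: "closed {x::'a \<Rightarrow> real. \<forall>v. v \<notin> C \<longrightarrow> x v = 0}"
    by (intro closed_Collect_all closed_Collect_imp closed_Collect_eq open_Collect_const
        continuous_on_const continuous_on_coord)
  have 3: "closed {x::'a \<Rightarrow> real. sum x V = 1}"
    by (intro closed_Collect_eq continuous_on_sum continuous_on_const continuous_on_coord)
  show cl: "closed (geom_realization V (Pow C))" unfolding eq by (intro closed_Int 1 2 3)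
  have "compactin (product_topology (\<lambda>_. euclideanreal) UNIV) (PiE UNIV (\<lambda>_::'a. {0..1::real}))"
    by (simp add: compactin_PiE)
  then have box: "compact (PiE UNIV (\<lambda>_::'a. {0..1::real}))"
    by (simp add: euclidean_product_topology)
  have "geom_realization V (Pow C) \<subseteq> PiE UNIV (\<lambda>_. {0..1})"
  proof
    fix x assume x: "x \<in> geom_realization V (Pow C)"
    have "x v \<le> 1" for v
    proof (cases "v \<in> V")
      case True
      then have "x v \<le> sum x V"
        using geom_realizationD(1)[OF x] assms(1) by (intro member_le_sum) auto
      then show ?thesis using geom_realizationD(3)[OF x] by simp
    next
      case False
      then show ?thesis using geom_realizationD(2)[OF x] by simp
    qed
    then show "x \<in> PiE UNIV (\<lambda>_. {0..1})" using geom_realizationD(1)[OF x] by auto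
  qed
  then have "geom_realization V (Pow C) = PiE UNIV (\<lambda>_. {0..1}) \<inter> geom_realization V (Pow C)" by blast
  then show "compact (geom_realization V (Pow C))" using compact_Int_closed[OF box cl] by simp
qed

lemma geom_realization_Union_simplices:
  assumes "subset_closed K"
  shows "geom_realization V K = (\<Union>C\<in>K. geom_realization V (Pow C))"
  using subset_closedD[OF assms] by (auto simp: geom_realization_def)

lemma
  assumes "finite V" "\<Union>K \<subseteq> V" "subset_closed K"
  shows compact_geom_realization: "compact (geom_realization V K)"
    and closed_geom_realization: "closed (geom_realization V K)"
proof -
  have "K \<subseteq> Pow V" using assms by auto
  then have "finite K" using assms(1) finite_subset by auto
  moreover have "C \<subseteq> V" if "C \<in> K" for C using that assms(2) by auto
  ultimately show "compact (geom_realization V K)" "closed (geom_realization V K)"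
    unfolding geom_realization_Union_simplices[OF assms(3)]
    using compact_simplex[OF assms(1)] by (auto intro!: compact_UN closed_UN)
qed

text \<open>The enumeration names the coordinates of the target sphere. The vertex
  \<open>e 0\<close> serves as reference for differences, which frees coordinate 0 for the least
  barycentric coordinate.\<close>

locale enumerated_simplex =
  fixes V C :: "'a set" and e :: "nat \<Rightarrow> 'a" and k :: nat
  assumes finV: "finite V" and CV: "C \<subseteq> V" and Cne: "C \<noteq> {}"
    and k: "k = card C" and e: "bij_betw e {..<k} C"
begin

abbreviation D :: "('a \<Rightarrow> real) set" where "D \<equiv> geom_realization V (Pow C)"

lemma finC: "finite C" using finV CV finite_subset by blast

lemma k_pos: "0 < k" using k finC Cne by (simp add: card_gt_0_iff)

lemma e_mem: "i < k \<Longrightarrow> e i \<in> C" using e by (auto simp: bij_betw_def)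

lemma e_surj: "v \<in> C \<Longrightarrow> \<exists>i<k. v = e i" using e by (auto simp: bij_betw_def)

lemma D_zero: "x \<in> D \<Longrightarrow> v \<notin> C \<Longrightarrow> x v = 0"
  by (auto simp: geom_realization_def)

lemma D_sum: "x \<in> D \<Longrightarrow> sum x C = 1"
proof -
  assume x: "x \<in> D"
  have "sum x C = sum x V" using finV CV D_zero[OF x] by (intro sum.mono_neutral_left) auto
  then show ?thesis using geom_realizationD(3)[OF x] by simp
qed

lemma DI: "(\<And>v. 0 \<le> x v) \<Longrightarrow> (\<And>v. v \<notin> C \<Longrightarrow> x v = 0) \<Longrightarrow> sum x C = 1 \<Longrightarrow> x \<in> D"
proof -
  assume x: "\<And>v. 0 \<le> x v" "\<And>v. v \<notin> C \<Longrightarrow> x v = 0" "sum x C = 1"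
  have "sum x C = sum x V" using finV CV x(2) by (intro sum.mono_neutral_left) auto
  then show ?thesis using x CV by (auto simp: geom_realization_def)
qed

lemma card_min_coord_le: "x \<in> D \<Longrightarrow> real k * min_coord C x \<le> 1"
proof -
  assume x: "x \<in> D"
  have "(\<Sum>v\<in>C. min_coord C x) \<le> sum x C" by (intro sum_mono min_coord_le finC)
  then show ?thesis using D_sum[OF x] k by simp
qed

lemma min_coord_D: "x \<in> D \<Longrightarrow> 0 \<le> min_coord C x" "x \<in> D \<Longrightarrow> 0 < min_coord C x \<longleftrightarrow> support x = C"
proof -
  assume x: "x \<in> D"
  show "0 \<le> min_coord C x" using min_coord_pos_iff(2)[OF x finC Cne] .
  have "support x \<subseteq> C" using D_zero[OF x] by blast
  then show "0 < min_coord C x \<longleftrightarrow> support x = C"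
    using min_coord_pos_iff(1)[OF x finC Cne] by blast
qed

text \<open>\<open>sphere_map\<close> sends the interior of the simplex homeomorphically to \<open>\<real>\<^sup>d\<close>, by
  \<open>x \<mapsto> (x\<^sub>b - x\<^sub>0) / min x\<close>, and then by inversion of the hyperplane \<open>p\<^sub>0 = 2\<close> at the origin
  to the sphere of radius \<open>1\<close> about \<open>(1, 0, \<dots>, 0)\<close>; the boundary goes to the origin.\<close>
definition dir :: "('a \<Rightarrow> real) \<Rightarrow> nat \<Rightarrow> real" where
  "dir x b = (if b = 0 then 2 * min_coord C x else x (e b) - x (e 0))"

definition dir_sq :: "('a \<Rightarrow> real) \<Rightarrow> real" where
  "dir_sq x = (\<Sum>b<k. (dir x b)\<^sup>2)"

definition sphere_map :: "('a \<Rightarrow> real) \<Rightarrow> nat \<Rightarrow> real" where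
  "sphere_map x b = (if b < k then 4 * min_coord C x * dir x b / dir_sq x else 0)"

lemma dir_sq_pos: "x \<in> D \<Longrightarrow> 0 < dir_sq x"
proof (rule ccontr)
  assume x: "x \<in> D" and "\<not> 0 < dir_sq x"
  moreover have "0 \<le> dir_sq x" unfolding dir_sq_def by (intro sum_nonneg) auto
  ultimately have "dir_sq x = 0" by simp
  then have 0: "dir x b = 0" if "b < k" for b
    using that unfolding dir_sq_def by (subst (asm) sum_nonneg_eq_0_iff) auto
  have "min_coord C x = 0" using 0[OF k_pos] by (simp add: dir_def)
  then obtain u where u: "u \<in> C" "x u = 0" using min_coord_attained[OF finC Cne] by metis
  have const: "x v = x (e 0)" if v: "v \<in> C" for v
  proof -
    obtain b where "b < k" "v = e b" using e_surj[OF v] by blast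
    then show ?thesis using 0[of b] by (cases "b = 0") (auto simp: dir_def)
  qed
  then have "x v = 0" if "v \<in> C" for v using u that by metis
  then have "sum x C = 0" by simp
  then show False using D_sum[OF x] by simp
qed

lemma continuous_on_sphere_map: "continuous_on D (\<lambda>x. sphere_map x b)"
proof -
  have d: "continuous_on D (\<lambda>x. dir x b)" for b
    unfolding dir_def using continuous_on_min_coord[OF finC Cne, of D]
    by (cases "b = 0") (auto intro!: continuous_intros)
  have "continuous_on D dir_sq" unfolding dir_sq_def by (intro continuous_intros d)
  then show ?thesis
    unfolding sphere_map_def using dir_sq_pos continuous_on_min_coord[OF finC Cne, of D]
    by (cases "b < k") (auto intro!: continuous_intros d simp: less_imp_neq[THEN not_sym] dest: dir_sq_pos)
qed

lemma sphere_map_zero: "min_coord C x = 0 \<Longrightarrow> sphere_map x b = 0"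
  by (simp add: sphere_map_def)

text \<open>The sphere equation thus reads: the squared norm of \<open>p\<close> equals
  \<open>2 * p 0\<close>.\<close>

lemma sum_sphere_expand:
  fixes p :: "nat \<Rightarrow> real"
  shows "(\<Sum>i<k. (p i - (if i = 0 then 1 else 0))\<^sup>2) = (\<Sum>i<k. (p i)\<^sup>2) - 2 * p 0 + 1"
proof -
  have "(\<Sum>i<k. (p i - (if i = 0 then 1 else 0))\<^sup>2) = (\<Sum>i<k. (p i)\<^sup>2 + (if i = 0 then 1 - 2 * p 0 else 0))"
    by (intro sum.cong) (auto simp: power2_eq_square algebra_simps)
  also have "\<dots> = (\<Sum>i<k. (p i)\<^sup>2) + (1 - 2 * p 0)"
    using k_pos by (simp add: sum.distrib)
  finally show ?thesis by simp
qed

lemma sphere_map_on_sphere: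
  assumes x: "x \<in> D"
  shows "(\<Sum>i<k. (sphere_map x i - (if i = 0 then 1 else 0))\<^sup>2) = 1"
proof -
  let ?m = "min_coord C x"
  have pos: "0 < dir_sq x" by (rule dir_sq_pos[OF x])
  have "(\<Sum>i<k. (sphere_map x i)\<^sup>2) = (\<Sum>i<k. (4 * ?m / dir_sq x)\<^sup>2 * (dir x i)\<^sup>2)"
    by (intro sum.cong) (auto simp: sphere_map_def power_mult_distrib power_divide)
  also have "\<dots> = (4 * ?m / dir_sq x)\<^sup>2 * dir_sq x"
    by (simp add: dir_sq_def sum_distrib_left)
  also have "\<dots> = 16 * ?m\<^sup>2 / dir_sq x" using pos by (simp add: power2_eq_square)
  also have "\<dots> = 2 * sphere_map x 0"
    using k_pos by (simp add: sphere_map_def dir_def power2_eq_square)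
  finally show ?thesis by (simp add: sum_sphere_expand)
qed

lemma sphere_map_0_pos: "x \<in> D \<Longrightarrow> 0 < min_coord C x \<Longrightarrow> 0 < sphere_map x 0"
  using k_pos dir_sq_pos by (simp add: sphere_map_def dir_def)

text \<open>Ratios of the image coordinates recover all differences divided by the minimum. So
  \<open>x / ?m\<close> and \<open>y / ?n\<close> differ by a constant on \<open>C\<close>; it is 0
  as both have minimum 1, and the coordinate sum 1 then gives \<open>?m = ?n\<close>.\<close>

lemma sphere_map_inj:
  assumes x: "x \<in> D" "0 < min_coord C x" and y: "y \<in> D" "0 < min_coord C y"
    and eq: "\<And>b. sphere_map x b = sphere_map y b"
  shows "x = y"
proof -
  let ?m = "min_coord C x" and ?n = "min_coord C y"
  have ratio: "(z (e b) - z (e 0)) / min_coord C z = 2 * sphere_map z b / sphere_map z 0"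
    if "z \<in> D" "0 < min_coord C z" "0 < b" "b < k" for z b
    using that dir_sq_pos[OF that(1)] k_pos by (simp add: sphere_map_def dir_def field_simps)
  define c where "c = x (e 0) / ?m - y (e 0) / ?n"
  have shift: "x v / ?m = y v / ?n + c" if v: "v \<in> C" for v
  proof -
    obtain b where b: "b < k" "v = e b" using e_surj[OF v] by blast
    show ?thesis
    proof (cases "b = 0")
      case True
      then show ?thesis using b by (simp add: c_def)
    next
      case False
      then have "(x v - x (e 0)) / ?m = (y v - y (e 0)) / ?n"
        using ratio[OF x, of b] ratio[OF y, of b] b eq by simp
      then show ?thesis by (simp add: c_def diff_divide_distrib)
    qed
  qed
  obtain u where u: "u \<in> C" "?m = x u" using min_coord_attained[OF finC Cne] by metis
  obtain w where w: "w \<in> C" "?n = y w" using min_coord_attained[OF finC Cne] by metis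
  have "1 = y u / ?n + c" using shift[OF u(1)] u(2) x(2) by simp
  moreover have "1 \<le> y u / ?n" using min_coord_le[OF finC u(1), of y] y(2) by simp
  ultimately have c1: "c \<le> 0" by linarith
  have "x w / ?m = 1 + c" using shift[OF w(1)] w(2) y(2) by simp
  moreover have "1 \<le> x w / ?m" using min_coord_le[OF finC w(1), of x] x(2) by simp
  ultimately have "c = 0" using c1 by linarith
  then have s: "x v / ?m = y v / ?n" if "v \<in> C" for v using shift[OF that] by simp
  have "(\<Sum>v\<in>C. x v / ?m) = (\<Sum>v\<in>C. y v / ?n)" using s by (intro sum.cong) auto
  then have "?m = ?n" using D_sum[OF x(1)] D_sum[OF y(1)] x(2) y(2) by (simp flip: sum_divide_distrib)
  show ?thesis
  proof
    fix v show "x v = y v"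
    proof (cases "v \<in> C")
      case True
      then show ?thesis using s[OF True] \<open>?m = ?n\<close> x(2) by simp
    next
      case False
      then show ?thesis using D_zero[OF x(1)] D_zero[OF y(1)] by simp
    qed
  qed
qed

lemma sphere_map_surj:
  fixes p :: "nat \<Rightarrow> real"
  assumes p: "(\<Sum>i<k. (p i - (if i = 0 then 1 else 0))\<^sup>2) = 1" "\<And>b. k \<le> b \<Longrightarrow> p b = 0" "p b0 \<noteq> 0"
  shows "\<exists>x\<in>D. 0 < min_coord C x \<and> sphere_map x = p"
proof -
  have sq: "(\<Sum>i<k. (p i)\<^sup>2) = 2 * p 0" using p(1) sum_sphere_expand[of p] by simp
  have "b0 < k" using p(2,3) by (meson not_le)
  then have "(p b0)\<^sup>2 \<le> (\<Sum>i<k. (p i)\<^sup>2)" by (intro member_le_sum) auto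
  moreover have "0 < (p b0)\<^sup>2" using p(3) by simp
  ultimately have p0: "0 < p 0" using sq by linarith
  \<comment> \<open>The differences relative to vertex 0 in units of the minimum, as read off in the
    injectivity proof. Shifting them to minimum 1 and dividing by their sum \<open>T\<close> gives
    the point sought, with least coordinate \<open>1 / T\<close>.\<close>
  define Z where "Z b = (if b = 0 then 0 else 2 * p b / p 0)" for b
  define \<mu> where "\<mu> = Min (Z ` {..<k})"
  define y where "y b = Z b - \<mu> + 1" for b
  have Zmu: "\<mu> \<le> Z b" if "b < k" for b using that by (auto simp: \<mu>_def)
  have "\<mu> \<in> Z ` {..<k}" unfolding \<mu>_def using k_pos by (intro Min_in) auto
  then obtain bm where bm: "bm < k" "Z bm = \<mu>" by auto
  have y1: "1 \<le> y b" if "b < k" for b using Zmu[OF that] by (simp add: y_def)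
  define T where "T = (\<Sum>b<k. y b)"
  have "1 \<le> y 0" using y1 k_pos by blast
  also have "y 0 \<le> T" unfolding T_def using k_pos y1 by (intro member_le_sum) (force simp: less_eq_real_def)+
  finally have T: "0 < T" by simp
  define g where "g = inv_into {..<k} e"
  have g: "g (e b) = b" if "b < k" for b
    using that e unfolding g_def bij_betw_def by (intro inv_into_f_f) auto
  define x where "x v = (if v \<in> C then y (g v) / T else 0)" for v
  have xe: "x (e b) = y b / T" if "b < k" for b using that e_mem g by (simp add: x_def)
  have nonneg: "0 \<le> x v" for v
  proof (cases "v \<in> C")
    case True
    then obtain b where b: "b < k" "v = e b" using e_surj by blast
    then show ?thesis using xe[OF b(1)] y1[OF b(1)] T by simp
  qed (simp add: x_def)
  have "sum x C = (\<Sum>b<k. x (e b))" using sum.reindex_bij_betw[OF e, of x] by simp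
  also have "\<dots> = (\<Sum>b<k. y b / T)" using xe by (intro sum.cong) auto
  also have "\<dots> = 1" using T by (simp add: T_def flip: sum_divide_distrib)
  finally have xD: "x \<in> D" using nonneg by (intro DI) (auto simp: x_def)
  have m: "min_coord C x = 1 / T"
  proof (rule antisym)
    have "x (e bm) = 1 / T" using xe[OF bm(1)] bm(2) by (simp add: y_def)
    then show "min_coord C x \<le> 1 / T" using min_coord_le[OF finC e_mem[OF bm(1)], of x] by simp
    obtain u where u: "u \<in> C" "min_coord C x = x u" using min_coord_attained[OF finC Cne] by metis
    then obtain b where b: "b < k" "u = e b" using e_surj by blast
    then show "1 / T \<le> min_coord C x" using u xe[OF b(1)] y1[OF b(1)] T by (simp add: divide_right_mono)
  qed
  \<comment> \<open>Forced by coordinate 0 of \<open>dir x\<close>, which is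
    \<open>2 / T\<close>.\<close>
  define \<kappa> where "\<kappa> = 2 / (p 0 * T)"
  have lam: "\<kappa> \<noteq> 0" using T p0 by (simp add: \<kappa>_def)
  have d: "dir x b = \<kappa> * p b" if "b < k" for b
  proof (cases "b = 0")
    case True
    then show ?thesis using p0 by (simp add: dir_def m \<kappa>_def)
  next
    case False
    have "x (e b) - x (e 0) = Z b / T"
      using xe[OF that] xe[OF k_pos] by (simp add: y_def Z_def diff_divide_distrib add_divide_distrib)
    then show ?thesis using False by (simp add: dir_def Z_def \<kappa>_def)
  qed
  have "dir_sq x = (\<Sum>b<k. \<kappa>\<^sup>2 * (p b)\<^sup>2)"
    unfolding dir_sq_def using d by (intro sum.cong) (auto simp: power_mult_distrib)
  also have "\<dots> = \<kappa>\<^sup>2 * (2 * p 0)" by (simp add: sq flip: sum_distrib_left)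
  finally have ds: "dir_sq x = \<kappa>\<^sup>2 * (2 * p 0)" .
  have "sphere_map x b = p b" for b
  proof (cases "b < k")
    case True
    have "sphere_map x b = 4 * (1 / T) * (\<kappa> * p b) / (\<kappa>\<^sup>2 * (2 * p 0))"
      using True d ds m by (simp add: sphere_map_def)
    also have "\<dots> = p b * (2 / (p 0 * T)) / \<kappa>" using lam p0 T by (simp add: power2_eq_square field_simps)
    also have "\<dots> = p b" using lam by (simp flip: \<kappa>_def)
    finally show ?thesis .
  next
    case False
    then show ?thesis using p(2) by (simp add: sphere_map_def)
  qed
  then show ?thesis using xD m T by (intro bexI[of _ x]) auto
qed

text \<open>\<open>push t\<close> scales about the barycentre by the factor \<open>1 + t\<close> and stops at the boundary, which
  \<open>x\<close> reaches when \<open>radius x * (1 + t) = 1\<close>; the excess \<open>radius x * (1 + t) - 1\<close> is then the time for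
  which a homotopy on the boundary is applied (homotopy extension).\<close>
definition radius :: "('a \<Rightarrow> real) \<Rightarrow> real" where
  "radius x = 1 - real k * min_coord C x"

definition push :: "real \<Rightarrow> ('a \<Rightarrow> real) \<Rightarrow> 'a \<Rightarrow> real" where
  "push t x v = (if v \<in> C then 1 / k + (x v - 1 / k) / max (1 / (1 + t)) (radius x) else 0)"

lemma radius_bounds: "x \<in> D \<Longrightarrow> 0 \<le> radius x" "x \<in> D \<Longrightarrow> radius x \<le> 1"
  using card_min_coord_le min_coord_D(1) by (auto simp: radius_def)

text \<open>The maximum caps the factor \<open>1 + t\<close> without dividing by
  \<open>radius x\<close>, which is 0 at the barycentre.\<close>

lemma push_scale_pos: "0 \<le> t \<Longrightarrow> 0 < max (1 / (1 + t)) (radius x)"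
  by (simp add: less_max_iff_disj)

lemma push_D:
  assumes x: "x \<in> D" and t: "0 \<le> t"
  shows "push t x \<in> D"
proof (rule DI)
  let ?\<mu> = "max (1 / (1 + t)) (radius x)"
  have mu: "0 < ?\<mu>" by (rule push_scale_pos[OF t])
  show "0 \<le> push t x v" for v
  proof (cases "v \<in> C")
    case True
    have "(1 / k - x v) \<le> 1 / k - min_coord C x" using min_coord_le[OF finC True, of x] by simp
    also have "\<dots> = radius x / k" using k_pos by (simp add: radius_def field_simps)
    also have "\<dots> \<le> ?\<mu> / k" by (intro divide_right_mono) auto
    finally have "(1 / k - x v) / ?\<mu> \<le> (?\<mu> / k) / ?\<mu>" using mu by (intro divide_right_mono) auto
    then have "(1 / k - x v) / ?\<mu> \<le> 1 / k" using mu by simp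
    moreover have "(x v - 1 / k) / ?\<mu> = - ((1 / k - x v) / ?\<mu>)" by (metis minus_diff_eq minus_divide_left)
    ultimately show ?thesis using True unfolding push_def by simp
  qed (simp add: push_def)
  have "sum (push t x) C = (\<Sum>v\<in>C. 1 / k + (x v - 1 / k) / ?\<mu>)"
    by (intro sum.cong) (auto simp: push_def)
  also have "\<dots> = (\<Sum>v\<in>C. 1 / k) + (sum x C - (\<Sum>v\<in>C. 1 / k)) / ?\<mu>"
    by (simp add: sum.distrib sum_subtractf flip: sum_divide_distrib)
  also have "(\<Sum>v\<in>C. 1 / real k) = 1" using k k_pos by simp
  finally show "sum (push t x) C = 1" using D_sum[OF x] by simp
qed (simp add: push_def)

lemma push_boundary:
  assumes x: "x \<in> D" and t: "0 \<le> t" and r: "1 \<le> radius x * (1 + t)"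
  shows "min_coord C (push t x) = 0"
proof -
  have "1 / (1 + t) \<le> radius x" using r t by (simp add: divide_le_eq)
  then have mu: "max (1 / (1 + t)) (radius x) = radius x" by simp
  have rp: "0 < radius x" using push_scale_pos[OF t, of x] mu by simp
  obtain u where u: "u \<in> C" "min_coord C x = x u" using min_coord_attained[OF finC Cne] by metis
  \<comment> \<open>A least coordinate lies \<open>radius x / k\<close> below the barycentre, so the
    factor \<open>1 / radius x\<close> takes it exactly to 0.\<close>
  have "x u - 1 / k = - (radius x / k)" using u k_pos by (simp add: radius_def field_simps)
  then have "push t x u = 1 / k + - (radius x / k) / radius x" using u(1) unfolding push_def mu by simp
  also have "\<dots> = 0" using rp by simp
  finally have "push t x u = 0" .
  then have "min_coord C (push t x) \<le> 0" using min_coord_le[OF finC u(1), of "push t x"] by simp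
  then show ?thesis using min_coord_D(1)[OF push_D[OF x t]] by simp
qed

lemma push_id:
  assumes x: "x \<in> D" and "t = 0 \<or> min_coord C x = 0" "0 \<le> t"
  shows "push t x = x"
proof -
  have "max (1 / (1 + t)) (radius x) = 1"
    using assms radius_bounds[OF x] by (auto simp: radius_def max_def)
  then show ?thesis using D_zero[OF x] by (auto simp: push_def fun_eq_iff)
qed

lemma continuous_on_radius: "continuous_on S radius"
  unfolding radius_def by (intro continuous_intros continuous_on_min_coord finC Cne)

lemma continuous_on_push: "continuous_on ({0..1::real} \<times> S) (\<lambda>p. push (fst p) (snd p))"
proof -
  have c: "continuous_on ({0..1::real} \<times> S) (\<lambda>p. snd p v)" for v
    by (rule continuous_on_compose2[OF continuous_on_coord[of UNIV v] continuous_on_snd[OF continuous_on_id]]) auto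
  have r: "continuous_on ({0..1::real} \<times> S) (\<lambda>p. radius (snd p))"
    by (rule continuous_on_compose2[OF continuous_on_radius[of UNIV] continuous_on_snd[OF continuous_on_id]]) auto
  have i: "continuous_on ({0..1::real} \<times> S) (\<lambda>p. 1 / (1 + fst p))"
    by (intro continuous_on_divide continuous_on_const continuous_on_add continuous_on_fst continuous_on_id) auto
  have "continuous_on ({0..1::real} \<times> S) (\<lambda>p. 1 / k + (snd p v - 1 / k) / max (1 / (1 + fst p)) (radius (snd p)))" for v
    using push_scale_pos by (intro continuous_on_add continuous_on_divide continuous_on_diff continuous_on_max
        continuous_on_const c r i) (force simp: less_imp_neq[THEN not_sym])
  then have "continuous_on ({0..1::real} \<times> S) (\<lambda>p. push (fst p) (snd p) v)" for v
    unfolding push_def by (cases "v \<in> C") simp_all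
  then show ?thesis by (rule continuous_on_coordinatewise_then_product)
qed

end

section \<open>Attaching facets to a contractible complex\<close>

text \<open>The subcomplex \<open>A\<close> is contractible, and the removed simplices meet it along
  their boundaries. Its contraction is extended over each simplex by pushing outwards; collapsing
  \<open>A\<close> then closes every simplex to a sphere through the common base point.\<close>

theorem contractible_plus_facets_wedge:
  fixes V :: "'a set"
  assumes V: "finite V" "\<Union>K \<subseteq> V" and K: "subset_closed K" and \<C>: "\<C> \<subseteq> K"
    and ne: "nonevasive (K - \<C>)" and facet: "\<And>C F. C \<in> \<C> \<Longrightarrow> F \<in> K \<Longrightarrow> C \<subseteq> F \<Longrightarrow> F = C"
  shows "\<exists>ds. top_of_set (geom_realization V K) homotopy_equivalent_space wedge_spheres ds"
proof -
  define X where "X = geom_realization V K"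
  define A where "A = geom_realization V (K - \<C>)"
  define D where "D C = geom_realization V (Pow C)" for C :: "'a set"
  have "K \<subseteq> Pow V" using V(2) by auto
  then have "finite K" using V(1) finite_subset by auto
  then have "finite \<C>" using \<C> finite_subset by blast
  then obtain Cs where Cs: "set Cs = \<C>" "distinct Cs" using finite_distinct_list by blast
  have finC: "finite C" and CV: "C \<subseteq> V" and Cne: "C \<noteq> {}" if "C \<in> \<C>" for C
  proof -
    show "C \<subseteq> V" using that \<C> V(2) by auto
    then show "finite C" using V(1) finite_subset by blast
    show "C \<noteq> {}" using nonevasive_complex(2)[OF ne] that by auto
  qed
  have "\<forall>C\<in>\<C>. \<exists>f. bij_betw f {..<card C} C"
    using finC ex_bij_betw_nat_finite by (metis atLeast0LessThan)
  then obtain e where e: "\<And>C. C \<in> \<C> \<Longrightarrow> bij_betw (e C) {..<card C} C" by metis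
  have spx: "enumerated_simplex V C (e C) (card C)" if "C \<in> \<C>" for C
    using V(1) CV[OF that] Cne[OF that] e[OF that] by unfold_locales auto
  define sm where "sm C = enumerated_simplex.sphere_map C (e C) (card C)" for C :: "'a set"
  define rad where "rad C = enumerated_simplex.radius C (card C)" for C :: "'a set"
  define psh where "psh C = enumerated_simplex.push C (card C)" for C :: "'a set"
  have DX: "D C \<subseteq> X" if "C \<in> \<C>" for C
    using that \<C> subset_closedD[OF K] unfolding D_def X_def by (intro geom_realization_mono) blast
  have AX: "A \<subseteq> X" unfolding A_def X_def by (intro geom_realization_mono) auto
  have supp_le: "support x \<subseteq> C" if "x \<in> D C" for x C using geom_realizationD(4)[of x V] that by (auto simp: D_def)
  \<comment> \<open>A proper face of a facet is not a facet, so no boundary face has been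
    removed.\<close>
  have supp_bd: "support x \<notin> \<C>" if "x \<in> D C" "C \<in> \<C>" "support x \<noteq> C" for x C
    using facet[of "support x" C] supp_le[OF that(1)] that \<C> by blast
  have bd: "x \<in> A" if "x \<in> D C" "C \<in> \<C>" "min_coord C x = 0" for x C
  proof -
    have "support x \<noteq> C"
      using enumerated_simplex.min_coord_D(2)[OF spx[OF that(2)], of x] that by (auto simp: D_def)
    then have "support x \<in> K - \<C>"
      using supp_bd that supp_le[OF that(1)] subset_closedD[OF K] \<C> by blast
    then show ?thesis using that(1) unfolding A_def D_def geom_realization_def by blast
  qed
  have min0: "min_coord C x = 0" if "x \<in> D C" "C \<in> \<C>" "support x \<noteq> C" for x C
    using enumerated_simplex.min_coord_D[OF spx[OF that(2)], of x] that by (fastforce simp: D_def)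
  have minpos: "0 < min_coord C x" if "x \<in> D C" "C \<in> \<C>" "support x = C" for x C
    using enumerated_simplex.min_coord_D[OF spx[OF that(2)], of x] that by (simp add: D_def)
  have Xcases: "x \<in> A \<or> (support x \<in> \<C> \<and> x \<in> D (support x))" if "x \<in> X" for x
    using that unfolding A_def X_def D_def geom_realization_def by blast
  have Asupp: "support x \<notin> \<C>" if "x \<in> A" for x using geom_realizationD(4)[of x V] that unfolding A_def by blast
  obtain a where "homotopic_with_canon (\<lambda>_. True) A A id (\<lambda>_. a)"
    using nonevasive_contractible[OF ne V(1)] V(2) unfolding contractible_space_def A_def by blast
  then obtain h where "continuous_map (prod_topology (top_of_set {0..1::real}) (top_of_set A)) (top_of_set A) h"
    and h0: "\<And>x. h (0, x) = x" and h1: "\<And>x. h (1, x) = a"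
    unfolding homotopic_with_def by auto
  then have hc: "continuous_on ({0..1} \<times> A) h" and hA: "h ` ({0..1} \<times> A) \<subseteq> A"
    by (auto simp: continuous_map_subtopology_eu)
  have hA': "h (t, x) \<in> A" if "0 \<le> t" "t \<le> 1" "x \<in> A" for t x using hA that by force
  \<comment> \<open>On the boundary \<open>rad\<close> is 1, so the time passed to \<open>h\<close>
    is exactly \<open>t\<close>; in general it is at most 1 because \<open>rad\<close> is.\<close>
  define GC where "GC C p = (if rad C (snd p) * (1 + fst p) \<le> 1 then psh C (fst p) (snd p)
      else h (rad C (snd p) * (1 + fst p) - 1, psh C (fst p) (snd p)))" for C p
  define G where "G p = (if support (snd p) \<in> \<C> then GC (support (snd p)) p else h p)" for p
  have radb: "0 \<le> rad C x" "rad C x \<le> 1" if "C \<in> \<C>" "x \<in> D C" for C x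
    using enumerated_simplex.radius_bounds[OF spx[OF that(1)], of x] that(2) by (auto simp: rad_def D_def)
  have pshD: "psh C t x \<in> D C" if "C \<in> \<C>" "x \<in> D C" "0 \<le> t" for C t x
    using enumerated_simplex.push_D[OF spx[OF that(1)], of x t] that(2,3) by (auto simp: psh_def D_def)
  have pshA: "psh C t x \<in> A" if "C \<in> \<C>" "x \<in> D C" "0 \<le> t" "1 \<le> rad C x * (1 + t)" for C t x
    using enumerated_simplex.push_boundary[OF spx[OF that(1)], of x t] pshD[OF that(1-3)] that
    by (intro bd) (auto simp: psh_def D_def rad_def)
  have pshid: "psh C t x = x" if "C \<in> \<C>" "x \<in> D C" "0 \<le> t" "t = 0 \<or> min_coord C x = 0" for C t x
    using enumerated_simplex.push_id[OF spx[OF that(1)], of x t] that by (auto simp: psh_def D_def)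
  \<comment> \<open>The definition of \<open>G\<close> separates open simplices from
    \<open>A\<close>. Agreement on the closed simplices is needed to glue continuous maps over
    closed sets.\<close>
  have G_eq: "G (t, x) = GC C (t, x)" if C: "C \<in> \<C>" and x: "x \<in> D C" and t: "t \<in> {0..1}" for C t x
  proof (cases "support x = C")
    case True
    then show ?thesis using C by (simp add: G_def)
  next
    case False
    then have m: "min_coord C x = 0" using min0 C x by blast
    then have "rad C x = 1" by (simp add: rad_def enumerated_simplex.radius_def[OF spx[OF C]])
    moreover have "psh C t x = x" using pshid[OF C x] m t by simp
    ultimately have "GC C (t, x) = h (t, x)" using t h0[of x] by (auto simp: GC_def)
    then show ?thesis using supp_bd[OF x C False] by (simp add: G_def)
  qed
  have GC_cont: "continuous_on ({0..1} \<times> D C) (GC C)" if C: "C \<in> \<C>" for C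
  proof -
    let ?r = "\<lambda>p::real \<times> ('a \<Rightarrow> real). rad C (snd p) * (1 + fst p)"
    let ?S1 = "({0..1} \<times> D C) \<inter> {p. ?r p \<le> 1}" and ?S2 = "({0..1} \<times> D C) \<inter> {p. 1 \<le> ?r p}"
    have radc: "continuous_on UNIV (rad C)"
      unfolding rad_def by (rule enumerated_simplex.continuous_on_radius[OF spx[OF C]])
    have rc: "continuous_on S ?r" for S
      by (intro continuous_on_mult continuous_on_add continuous_on_const continuous_on_fst continuous_on_id
          continuous_on_compose2[OF radc continuous_on_snd[OF continuous_on_id]]) auto
    have cl: "closed ({0..1::real} \<times> D C)"
      using compact_simplex(2)[OF V(1) CV[OF C]] by (intro closed_Times) (auto simp: D_def)
    have clS: "closed ?S1" "closed ?S2"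
      by (intro closed_Int cl closed_Collect_le rc continuous_on_const)+
    have pc: "continuous_on ({0..1} \<times> D C) (\<lambda>p. psh C (fst p) (snd p))"
      unfolding psh_def by (rule enumerated_simplex.continuous_on_push[OF spx[OF C]])
    have c1: "continuous_on ?S1 (\<lambda>p. psh C (fst p) (snd p))"
      by (rule continuous_on_subset[OF pc]) auto
    have c2: "continuous_on ?S2 (\<lambda>p. h (?r p - 1, psh C (fst p) (snd p)))"
    proof (rule continuous_on_compose2[OF hc])
      show "continuous_on ?S2 (\<lambda>p. (?r p - 1, psh C (fst p) (snd p)))"
        by (intro continuous_on_Pair continuous_on_diff rc continuous_on_const continuous_on_subset[OF pc]) auto
      show "(\<lambda>p. (?r p - 1, psh C (fst p) (snd p))) ` ?S2 \<subseteq> {0..1} \<times> A"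
      proof clarify
        fix t x assume tx: "t \<in> {0..1}" "x \<in> D C" "1 \<le> rad C (snd (t, x)) * (1 + fst (t, x))"
        have "rad C x * (1 + t) \<le> 1 * (1 + 1)"
          using radb[OF C tx(2)] tx(1) by (intro mult_mono) auto
        then show "rad C (snd (t, x)) * (1 + fst (t, x)) - 1 \<in> {0..1} \<and> psh C (fst (t, x)) (snd (t, x)) \<in> A"
          using pshA[OF C tx(2)] tx by auto
      qed
    qed
    have "continuous_on (?S1 \<union> ?S2) (\<lambda>p. if ?r p \<le> 1 then psh C (fst p) (snd p) else h (?r p - 1, psh C (fst p) (snd p)))"
    proof (rule continuous_on_If[OF clS c1 c2])
      show "psh C (fst p) (snd p) = h (?r p - 1, psh C (fst p) (snd p))"
        if "p \<in> ?S2" "?r p \<le> 1" for p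
      proof -
        have "?r p - 1 = 0" using that by auto
        then show ?thesis using h0 by simp
      qed
    qed auto
    moreover have "?S1 \<union> ?S2 = {0..1} \<times> D C" by auto
    ultimately show ?thesis unfolding GC_def by simp
  qed
  have Xun: "X = A \<union> (\<Union>C\<in>\<C>. D C)" using AX DX Xcases by blast
  have KC: "subset_closed (K - \<C>)" by (rule nonevasive_complex(1)[OF ne])
  have Acl: "closed A" unfolding A_def by (rule closed_geom_realization[OF V(1) _ KC]) (use V(2) in auto)
  have Dcl: "closed (D C)" if "C \<in> \<C>" for C
    unfolding D_def by (rule compact_simplex(2)[OF V(1) CV[OF that]])
  have G_A: "G (t, x) = h (t, x)" if "x \<in> A" for t x using Asupp[OF that] by (simp add: G_def)
  have Gc: "continuous_on ({0..1} \<times> X) G"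
  proof -
    have "continuous_on ({0..1} \<times> A) G"
      using hc G_A by (auto intro: continuous_on_eq)
    moreover have "continuous_on (\<Union>C\<in>\<C>. {0..1} \<times> D C) G"
    proof (rule continuous_on_closed_Union[OF \<open>finite \<C>\<close>])
      fix C assume C: "C \<in> \<C>"
      show "closed ({0..1::real} \<times> D C)" by (intro closed_Times Dcl C) auto
      show "continuous_on ({0..1} \<times> D C) G"
        by (rule continuous_on_eq[OF GC_cont[OF C]]) (use G_eq[OF C] in auto)
    qed
    moreover have "closed ({0..1::real} \<times> A)" by (intro closed_Times Acl) auto
    moreover have "closed (\<Union>C\<in>\<C>. {0..1::real} \<times> D C)"
      by (intro closed_UN \<open>finite \<C>\<close> ballI closed_Times Dcl) auto
    ultimately have "continuous_on ({0..1} \<times> A \<union> (\<Union>C\<in>\<C>. {0..1} \<times> D C)) G"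
      by (intro continuous_on_closed_Un)
    moreover have "{0..1} \<times> X = {0..1} \<times> A \<union> (\<Union>C\<in>\<C>. {0..1::real} \<times> D C)" unfolding Xun by auto
    ultimately show ?thesis by simp
  qed
  have GX: "G (t, x) \<in> X" if t: "t \<in> {0..1}" and x: "x \<in> X" for t x
  proof (cases "x \<in> A")
    case True
    then show ?thesis using G_A hA' t AX by auto
  next
    case False
    then obtain C where C: "C \<in> \<C>" "x \<in> D C" using x Xun by blast
    show ?thesis
    proof (cases "rad C x * (1 + t) \<le> 1")
      case True
      then have "G (t, x) = psh C t x" using G_eq[OF C t] by (simp add: GC_def)
      then show ?thesis using pshD[OF C] t DX[OF C(1)] by auto
    next
      case False
      have "rad C x * (1 + t) \<le> 1 * (1 + 1)" using radb[OF C] t by (intro mult_mono) auto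
      then have "h (rad C x * (1 + t) - 1, psh C t x) \<in> A" using False pshA[OF C] t by (intro hA') auto
      then show ?thesis using G_eq[OF C t] False AX by (auto simp: GC_def)
    qed
  qed
  have G0: "G (0, x) = x" if x: "x \<in> X" for x
  proof (cases "x \<in> A")
    case True
    then show ?thesis using G_A h0 by simp
  next
    case False
    then obtain C where C: "C \<in> \<C>" "x \<in> D C" using x Xun by blast
    then show ?thesis using G_eq[OF C, of 0] radb[OF C] pshid[OF C, of 0] by (simp add: GC_def)
  qed
  define \<phi> where "\<phi> x = (\<lambda>(i, b). if i < length Cs \<and> support x = Cs ! i then sm (Cs ! i) x b else 0)"
    for x :: "'a \<Rightarrow> real"
  have nthC: "Cs ! i \<in> \<C>" if "i < length Cs" for i using that Cs(1) nth_mem by blast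
  have \<phi>_A: "\<phi> x = (\<lambda>_. 0)" if "x \<in> A" for x
    using Asupp[OF that] nthC by (auto simp: \<phi>_def fun_eq_iff)
  have \<phi>_D: "\<phi> x = (\<lambda>(i, b). if i = j then sm (Cs ! j) x b else 0)"
    if j: "j < length Cs" and x: "x \<in> D (Cs ! j)" for x j
  proof (cases "support x = Cs ! j")
    case True
    then show ?thesis using j nth_eq_iff_index_eq[OF Cs(2)] by (auto simp: \<phi>_def fun_eq_iff)
  next
    case False
    have "sm (Cs ! j) x b = 0" for b
      unfolding sm_def
      by (rule enumerated_simplex.sphere_map_zero[OF spx[OF nthC[OF j]] min0[OF x nthC[OF j] False]])
    then show ?thesis
      using supp_bd[OF x nthC[OF j] False] nthC by (auto simp: \<phi>_def fun_eq_iff)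
  qed
  have \<phi>c: "continuous_on X \<phi>"
  proof -
    have "continuous_on A (\<lambda>_. (\<lambda>_. 0) :: nat \<times> nat \<Rightarrow> real)" by (rule continuous_on_const)
    then have "continuous_on A \<phi>" by (rule continuous_on_eq) (simp add: \<phi>_A)
    moreover have "continuous_on (\<Union>C\<in>\<C>. D C) \<phi>"
    proof (rule continuous_on_closed_Union[OF \<open>finite \<C>\<close> Dcl])
      fix C assume C: "C \<in> \<C>"
      then obtain j where j: "j < length Cs" "C = Cs ! j" using Cs(1) by (metis in_set_conv_nth)
      have s: "continuous_on (D C) (\<lambda>x. sm C x b)" for b
        unfolding sm_def D_def by (rule enumerated_simplex.continuous_on_sphere_map[OF spx[OF C]])
      have "continuous_on (D C) (\<lambda>x. (case q of (i, b) \<Rightarrow> if i = j then sm C x b else 0))" for q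
        by (cases q; cases "fst q = j") (auto intro: s)
      then have "continuous_on (D C) (\<lambda>x. (\<lambda>(i, b). if i = j then sm C x b else 0))"
        by (rule continuous_on_coordinatewise_then_product)
      then show "continuous_on (D C) \<phi>"
        by (rule continuous_on_eq) (simp only: j(2) \<phi>_D[OF j(1)])
    qed
    moreover have "closed (\<Union>C\<in>\<C>. D C)" by (intro closed_UN \<open>finite \<C>\<close> ballI Dcl)
    ultimately show ?thesis unfolding Xun using Acl by (intro continuous_on_closed_Un)
  qed
  \<comment> \<open>A simplex with \<open>k\<close> vertices yields a sphere in \<open>k\<close>
    coordinates, of dimension \<open>k - 1\<close>; the subtraction is not truncated because removed
    simplices are nonempty.\<close>
  define ds where "ds = map (\<lambda>C. card C - 1) Cs"
  define W where "W = insert (\<lambda>_. 0) (\<Union>j<length ds. block_sphere j (ds ! j))"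
  have block: "y \<in> block_sphere j (ds ! j) \<longleftrightarrow>
      (\<Sum>i<card (Cs ! j). (y (j, i) - (if i = 0 then 1 else 0))\<^sup>2) = 1 \<and>
      (\<forall>i b. i \<noteq> j \<or> card (Cs ! j) \<le> b \<longrightarrow> y (i, b) = 0)" if j: "j < length Cs" for j y
  proof -
    have "0 < card (Cs ! j)" using finC Cne nthC[OF j] by (simp add: card_gt_0_iff)
    then have "Suc (ds ! j) = card (Cs ! j)" using j by (simp add: ds_def)
    then show ?thesis unfolding block_sphere_def by (auto simp flip: lessThan_Suc_atMost)
  qed
  have inW: "\<phi> x \<in> block_sphere j (ds ! j)" if j: "j < length Cs" and x: "x \<in> D (Cs ! j)" for x j
    unfolding block[OF j] \<phi>_D[OF j x] sm_def
    using enumerated_simplex.sphere_map_on_sphere[OF spx[OF nthC[OF j]], of x] x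
    by (auto simp: D_def enumerated_simplex.sphere_map_def[OF spx[OF nthC[OF j]]])
  \<comment> \<open>Supplies a preimage for the base point of the wedge.\<close>
  have "A \<noteq> {}"
  proof -
    have "\<not> K - \<C> \<subseteq> {{}}" using nonevasive_complex(2,3)[OF ne] by auto
    then obtain F where "F \<in> K - \<C>" "F \<noteq> {}" by auto
    then obtain v where v: "v \<in> F" "{v} \<in> K - \<C>" using subset_closedD[OF KC] by blast
    then have "v \<in> V" using V(2) by blast
    then have "(\<lambda>u. if u = v then 1 else 0) \<in> A"
      using V(1) v(2) by (auto simp: A_def geom_realization_def)
    then show ?thesis by blast
  qed
  have surj: "\<exists>x\<in>X. \<phi> x = y" if j: "j < length Cs" and y: "y \<in> block_sphere j (ds ! j)" "y \<noteq> (\<lambda>_. 0)" for y j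
  proof -
    obtain i b0 where ib: "y (i, b0) \<noteq> 0" using y(2) by (auto simp: fun_eq_iff)
    then have "i = j" using y(1) unfolding block[OF j] by blast
    then have "y (j, b0) \<noteq> 0" using ib by simp
    then obtain x where x: "x \<in> D (Cs ! j)" "sm (Cs ! j) x = (\<lambda>b. y (j, b))"
      using enumerated_simplex.sphere_map_surj[OF spx[OF nthC[OF j]], of "\<lambda>b. y (j, b)" b0] y(1)
      unfolding block[OF j] D_def sm_def by auto
    have "\<phi> x = y" unfolding \<phi>_D[OF j x(1)] x(2) using y(1) unfolding block[OF j] by (auto simp: fun_eq_iff)
    then show ?thesis using x(1) DX[OF nthC[OF j]] by blast
  qed
  have \<phi>W: "\<phi> ` X = W"
  proof
    show "\<phi> ` X \<subseteq> W"
    proof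
      fix y assume "y \<in> \<phi> ` X"
      then obtain x where x: "x \<in> X" "y = \<phi> x" by blast
      show "y \<in> W"
      proof (cases "x \<in> A")
        case True
        then show ?thesis using \<phi>_A x by (simp add: W_def)
      next
        case False
        then obtain C where "C \<in> \<C>" "x \<in> D C" using x Xun by blast
        then obtain j where "j < length Cs" "x \<in> D (Cs ! j)" using Cs(1) by (metis in_set_conv_nth)
        then show ?thesis using inW x(2) by (auto simp: W_def ds_def)
      qed
    qed
    show "W \<subseteq> \<phi> ` X"
    proof
      fix y assume y: "y \<in> W"
      show "y \<in> \<phi> ` X"
      proof (cases "y = (\<lambda>_. 0)")
        case True
        obtain x where "x \<in> A" using \<open>A \<noteq> {}\<close> by blast
        then show ?thesis using True \<phi>_A AX by (metis image_eqI subsetD)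
      next
        case False
        then obtain j where "j < length Cs" "y \<in> block_sphere j (ds ! j)" using y by (auto simp: W_def ds_def)
        then show ?thesis using surj False by blast
      qed
    qed
  qed
  \<comment> \<open>Coordinate 0 of its own block is positive off \<open>A\<close>. This separates
    open simplices from \<open>A\<close> and from one another.\<close>
  have pos: "\<exists>j<length Cs. support x = Cs ! j \<and> x \<in> D (Cs ! j) \<and> 0 < min_coord (Cs ! j) x \<and> 0 < \<phi> x (j, 0)"
    if "x \<in> X" "x \<notin> A" for x
  proof -
    have s: "support x \<in> \<C>" "x \<in> D (support x)" using Xcases that by auto
    then obtain j where j: "j < length Cs" "support x = Cs ! j" using Cs(1) by (metis in_set_conv_nth)
    have xD: "x \<in> D (Cs ! j)" using s j by simp
    have m: "0 < min_coord (Cs ! j) x" using minpos[OF xD nthC[OF j(1)] j(2)] .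
    have "0 < sm (Cs ! j) x 0"
      using enumerated_simplex.sphere_map_0_pos[OF spx[OF nthC[OF j(1)]] _ m] xD by (simp add: sm_def D_def)
    then have "0 < \<phi> x (j, 0)" using \<phi>_D[OF j(1) xD] by simp
    then show ?thesis using j xD m by blast
  qed
  have inj: "x = y \<or> x \<in> A \<and> y \<in> A" if x: "x \<in> X" and y: "y \<in> X" and eq: "\<phi> x = \<phi> y" for x y
  proof (cases "x \<in> A \<or> y \<in> A")
    case True
    then have "\<phi> x = (\<lambda>_. 0)" "\<phi> y = (\<lambda>_. 0)" using \<phi>_A eq by auto
    then show ?thesis using pos[OF x] pos[OF y] by auto
  next
    case False
    obtain i where i: "i < length Cs" "x \<in> D (Cs ! i)" "0 < min_coord (Cs ! i) x" "0 < \<phi> x (i, 0)"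
      using pos[OF x] False by blast
    obtain j where j: "j < length Cs" "y \<in> D (Cs ! j)" "0 < min_coord (Cs ! j) y" "0 < \<phi> y (j, 0)"
      using pos[OF y] False by blast
    have "i = j" using i(4) eq \<phi>_D[OF j(1,2)] by (auto split: if_splits)
    have "sm (Cs ! i) x b = sm (Cs ! i) y b" for b
      using fun_cong[OF eq, of "(i, b)"] \<phi>_D[OF i(1,2)] \<phi>_D[OF j(1,2)] \<open>i = j\<close> by simp
    then have "x = y"
      using enumerated_simplex.sphere_map_inj[OF spx[OF nthC[OF i(1)]], of x y] i j \<open>i = j\<close>
      by (simp add: sm_def D_def)
    then show ?thesis ..
  qed
  have "top_of_set X homotopy_equivalent_space top_of_set W"
  proof (rule homotopy_equivalent_collapse[OF _ \<phi>c \<phi>W AX inj _ Gc])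
    show "compact X" unfolding X_def by (rule compact_geom_realization[OF V K])
    show "\<phi> x = \<phi> y" if "x \<in> A" "y \<in> A" for x y using \<phi>_A that by simp
    show "G ` ({0..1} \<times> X) \<subseteq> X" using GX by auto
    show "G ` ({0..1} \<times> A) \<subseteq> A" using G_A hA' by auto
    show "G (0, x) = x" if "x \<in> X" for x using G0 that .
    show "G (1, x) = a" if "x \<in> A" for x using G_A h1 that by simp
  qed
  then show ?thesis unfolding X_def W_def wedge_spheres_def[symmetric] by blast
qed

section \<open>Homotopy type of the intersection lattice\<close>

lemma subset_closed_order_complex: "subset_closed (order_complex P le)"
  unfolding subset_closed_def order_complex_def by (auto intro: finite_subset)

theorem theorem1p1:
  fixes n :: nat and \<Delta> :: "nat set set"
  assumes "simplicial_complex_on n \<Delta>"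
    and "shellable \<Delta>"
    and "cx_dim_le \<Delta> (int n - 3)"
  shows "htype_wedge_of_spheres
           (top_of_set (geom_realization (proper_part n \<Delta>)
              (order_complex (proper_part n \<Delta>) (\<lambda>x y. y \<subseteq> x))))"
proof (cases "proper_part n \<Delta> = {}")
  \<comment> \<open>Without vertices the coordinates cannot sum to 1, so the realization is empty,
    the sphere of dimension -1.\<close>
  case True
  then show ?thesis by (simp add: htype_wedge_of_spheres_def geom_realization_def)
next
  case False
  let ?A = "diag_arrangement n \<Delta>" and ?P = "proper_part n \<Delta>"
  have lat: "intersection_lattice n \<Delta> = meets (Rn n) ?A"
    by (simp add: intersection_lattice_def meets_def)
  have "finite_meet_semilattice (intersection_lattice n \<Delta>)"
  proof -
    interpret diagonal_lattice n "(\<lambda>F. {1..n} - F) ` facets \<Delta>"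
      by unfold_locales auto
    show ?thesis using finite_meet_semilattice_axioms
      by (simp add: lat diag_arrangement_def image_image)
  qed
  then interpret finite_meet_semilattice "intersection_lattice n \<Delta>" .
  have P: "?P = inner_meets (Rn n) ?A" by (rule proper_part_eq_inner_meets)
  have Psub: "?P \<subseteq> {z \<in> intersection_lattice n \<Delta>. inf (Rn n) (Inf ?A) < z \<and> z < Rn n}"
  proof
    fix z assume z: "z \<in> ?P"
    then have "z \<in> meets (Rn n) ?A" "z \<noteq> Rn n" "z \<noteq> inf (Rn n) (Inf ?A)"
      unfolding P inner_meets_def by auto
    then show "z \<in> {z \<in> intersection_lattice n \<Delta>. inf (Rn n) (Inf ?A) < z \<and> z < Rn n}"
      using meets_le[of z] meets_ge[of z] unfolding lat by (auto simp: order.strict_iff_order)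
  qed
  have finP: "finite ?P" using finite_subset[OF Psub] finite_lattice by simp
  obtain \<C> where C: "\<C> \<subseteq> order_chains ?P" "nonevasive (order_chains ?P - \<C>)"
    "\<And>C. C \<in> \<C> \<Longrightarrow> maximal_in {z \<in> intersection_lattice n \<Delta>. inf (Rn n) (Inf ?A) < z \<and> z < Rn n} C"
    using shelled_almost_nonevasive[OF shellable_imp_shelled_arrangement[OF assms]] False
    unfolding P by blast
  have "\<exists>ds. top_of_set (geom_realization ?P (order_chains ?P)) homotopy_equivalent_space wedge_spheres ds"
  proof (rule contractible_plus_facets_wedge[OF finP _ subset_closed_order_complex C(1,2)])
    show "\<Union>(order_chains ?P) \<subseteq> ?P" by (auto simp: order_complex_def)
    fix C F assume CF: "C \<in> \<C>" "F \<in> order_chains ?P" "C \<subseteq> F"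
    \<comment> \<open>Every element of a chain containing \<open>C\<close> is comparable to all of
      \<open>C\<close>, so maximality puts it into \<open>C\<close>; the removed chains are
      facets.\<close>
    have "z \<in> C" if "z \<in> F" for z
    proof -
      have "z \<in> ?P" "C \<subseteq> comparable_in UNIV z"
        using CF(2,3) that unfolding order_complex_def comparable_in_def by blast+
      then show ?thesis using C(3)[OF CF(1)] Psub unfolding maximal_in_def by blast
    qed
    then show "F = C" using CF(3) by blast
  qed
  then show ?thesis unfolding htype_wedge_of_spheres_def by blast
qed

end
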